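(* Let $(E,F,G)$ be a triple of Fréchet spaces, and consider the conditions: (1) every subspace of $E$ contains a subspace isomorphic to $G$; (2) $F$ has no subspace isomorphic to $G$. If (1) and (2) hold, then $LB(E,F)=L_s(E,F)$, in the sense that every bounded continuous linear operator $T:E\to F$ is strictly singular. If in addition $F$ is a Fréchet-Montel space admitting a continuous norm, then (2) is also necessary: if (1) holds and $LB(E,F)=L_s(E,F)$, then (2) holds.
   Context: "Subspace" always means infinite dimensional closed subspace; isomorphic means linearly homeomorphic. A continuous linear operator $T:E\to F$ is bounded if it maps some neighborhood of the origin of $E$ into a bounded subset of $F$; $LB(E,F)$ is the set of such operators. $T$ is strictly singular if there is no infinite dimensional closed subspace $M$ of $E$ such that $T|_M$ is an isomorphism (linear homeomorphism) onto $T(M)$; $L_s(E,F)$ is the set of these. Following the paper, "$LB(E,F)=L_s(E,F)$" means that every bounded continuous linear operator from $E$ to $F$ is strictly singular. A Fréchet-Montel space is a Fréchet space in which every bounded set is relatively compact.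
   Formalization: In the converse part E is assumed infinite dimensional; for finite-dimensional E, condition (1) and LB(E,F)=L_s(E,F) hold vacuously, and the converse fails, e.g. for E the scalar field and F=G=s (rapidly decreasing sequences). *)

theory Defs
  imports "HOL-Analysis.Analysis"
begin

text \<open>The scalar field of a Frechet space is the field of real or of complex numbers. The
  following class has, up to isometric isomorphism, exactly these two instances.\<close>

class real_or_complex = real_normed_field +
  assumes real_or_complex:
    "(\<forall>z. \<exists>a. z = a *\<^sub>R 1) \<or>
     (\<exists>i. i * i = - 1 \<and>
        (\<forall>z. \<exists>a b. z = a *\<^sub>R 1 + b *\<^sub>R i) \<and>
        (\<forall>a b. norm (a *\<^sub>R 1 + b *\<^sub>R i) = sqrt (a\<^sup>2 + b\<^sup>2)))"

instance real :: real_or_complex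
  by standard auto

instance complex :: real_or_complex
proof
  have "\<forall>z. \<exists>a b. z = a *\<^sub>R 1 + b *\<^sub>R \<i>"
    by (metis complex_eq mult.commute scaleR_conv_of_real mult.right_neutral)
  moreover have "\<forall>a b. norm (a *\<^sub>R 1 + b *\<^sub>R \<i>) = sqrt (a\<^sup>2 + b\<^sup>2)"
    by (simp add: cmod_def)
  ultimately show "(\<forall>z::complex. \<exists>a. z = a *\<^sub>R 1) \<or>
     (\<exists>i::complex. i * i = - 1 \<and>
        (\<forall>z. \<exists>a b. z = a *\<^sub>R 1 + b *\<^sub>R i) \<and>
        (\<forall>a b. norm (a *\<^sub>R 1 + b *\<^sub>R i) = sqrt (a\<^sup>2 + b\<^sup>2)))"
    using i_squared by blast
qed

locale topological_vector_space = vector_space sc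
  for sc :: "'k::real_or_complex \<Rightarrow> 'e::topological_ab_group_add \<Rightarrow> 'e" +
  assumes continuous_scale: "continuous_on UNIV (\<lambda>(c, x). sc c x)"

definition convex_set :: "('k::real_or_complex \<Rightarrow> 'e::ab_group_add \<Rightarrow> 'e) \<Rightarrow> 'e set \<Rightarrow> bool"
  where "convex_set sc V \<longleftrightarrow>
    (\<forall>x\<in>V. \<forall>y\<in>V. \<forall>t\<in>{0..1}. sc (of_real (1 - t)) x + sc (of_real t) y \<in> V)"

text \<open>A Frechet space is a locally convex space whose topology is induced by a complete
  translation-invariant metric; such a metric has the same Cauchy sequences as the vector
  topology, so completeness does not depend on its choice.\<close>

locale frechet_space = topological_vector_space sc
  for sc :: "'k::real_or_complex \<Rightarrow> 'e::topological_ab_group_add \<Rightarrow> 'e" +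
  assumes locally_convex:
    "\<And>U. open U \<Longrightarrow> 0 \<in> U \<Longrightarrow> \<exists>V. open V \<and> 0 \<in> V \<and> convex_set sc V \<and> V \<subseteq> U"
  and complete_metrizable:
    "\<exists>d :: 'e \<Rightarrow> 'e \<Rightarrow> real. Metric_space UNIV d \<and> Metric_space.mtopology UNIV d = euclidean \<and>
         (\<forall>x y z. d (x + z) (y + z) = d x y) \<and> Metric_space.mcomplete UNIV d"

definition infinite_dimensional ::
    "('k::field \<Rightarrow> 'e::ab_group_add \<Rightarrow> 'e) \<Rightarrow> 'e set \<Rightarrow> bool"
  where "infinite_dimensional sc M \<longleftrightarrow> \<not> (\<exists>B. finite B \<and> module.span sc B = M)"

definition inf_closed_subspace ::
    "('k::field \<Rightarrow> 'e::{ab_group_add,topological_space} \<Rightarrow> 'e) \<Rightarrow> 'e set \<Rightarrow> bool"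
  where "inf_closed_subspace sc M \<longleftrightarrow>
    module.subspace sc M \<and> closed M \<and> infinite_dimensional sc M"

text \<open>Only the values of \<open>f\<close> on the linear subspace \<open>M\<close> matter.\<close>

definition isomorphism_between ::
    "('k::field \<Rightarrow> 'e::{ab_group_add,topological_space} \<Rightarrow> 'e) \<Rightarrow> 'e set \<Rightarrow>
     ('k \<Rightarrow> 'f::{ab_group_add,topological_space} \<Rightarrow> 'f) \<Rightarrow> 'f set \<Rightarrow> ('e \<Rightarrow> 'f) \<Rightarrow> bool"
  where "isomorphism_between s1 M s2 N f \<longleftrightarrow>
    (\<forall>x\<in>M. \<forall>y\<in>M. f (x + y) = f x + f y) \<and> (\<forall>c. \<forall>x\<in>M. f (s1 c x) = s2 c (f x)) \<and>
    (\<exists>g. homeomorphism M N f g)"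

definition isomorphic_subspaces ::
    "('k::field \<Rightarrow> 'e::{ab_group_add,topological_space} \<Rightarrow> 'e) \<Rightarrow> 'e set \<Rightarrow>
     ('k \<Rightarrow> 'f::{ab_group_add,topological_space} \<Rightarrow> 'f) \<Rightarrow> 'f set \<Rightarrow> bool"
  where "isomorphic_subspaces s1 M s2 N \<longleftrightarrow> (\<exists>f. isomorphism_between s1 M s2 N f)"

text \<open>Boundedness in the sense of topological vector spaces (absorption by every neighbourhood
  of the origin), not with respect to a metric.\<close>

definition tvs_bounded ::
    "('k::real_normed_field \<Rightarrow> 'e::{ab_group_add,topological_space} \<Rightarrow> 'e) \<Rightarrow> 'e set \<Rightarrow> bool"
  where "tvs_bounded sc B \<longleftrightarrow>
    (\<forall>U. open U \<longrightarrow> 0 \<in> U \<longrightarrow> (\<exists>r>0. \<forall>c. r \<le> norm c \<longrightarrow> B \<subseteq> sc c ` U))"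

definition continuous_linear_operators ::
    "('k::field \<Rightarrow> 'e::{ab_group_add,topological_space} \<Rightarrow> 'e) \<Rightarrow>
     ('k \<Rightarrow> 'f::{ab_group_add,topological_space} \<Rightarrow> 'f) \<Rightarrow> ('e \<Rightarrow> 'f) set"
  where "continuous_linear_operators sE sF =
    {T. Vector_Spaces.linear sE sF T \<and> continuous_on UNIV T}"

definition LB ::
    "('k::real_normed_field \<Rightarrow> 'e::{ab_group_add,topological_space} \<Rightarrow> 'e) \<Rightarrow>
     ('k \<Rightarrow> 'f::{ab_group_add,topological_space} \<Rightarrow> 'f) \<Rightarrow> ('e \<Rightarrow> 'f) set"
  where "LB sE sF = {T \<in> continuous_linear_operators sE sF.
    \<exists>U. open U \<and> 0 \<in> U \<and> tvs_bounded sF (T ` U)}"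

definition L_s ::
    "('k::field \<Rightarrow> 'e::{ab_group_add,topological_space} \<Rightarrow> 'e) \<Rightarrow>
     ('k \<Rightarrow> 'f::{ab_group_add,topological_space} \<Rightarrow> 'f) \<Rightarrow> ('e \<Rightarrow> 'f) set"
  where "L_s sE sF = {T \<in> continuous_linear_operators sE sF.
    \<not> (\<exists>M. inf_closed_subspace sE M \<and> isomorphism_between sE M sF (T ` M) T)}"

locale frechet_montel_space = frechet_space sc
  for sc :: "'k::real_or_complex \<Rightarrow> 'e::topological_ab_group_add \<Rightarrow> 'e" +
  assumes montel: "\<And>B. tvs_bounded sc B \<Longrightarrow> compact (closure B)"

definition admits_continuous_norm ::
    "('k::real_normed_field \<Rightarrow> 'e::{ab_group_add,topological_space} \<Rightarrow> 'e) \<Rightarrow> bool"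
  where "admits_continuous_norm sc \<longleftrightarrow>
    (\<exists>p :: 'e \<Rightarrow> real. continuous_on UNIV p \<and>
       (\<forall>x. 0 \<le> p x) \<and> (\<forall>x. p x = 0 \<longleftrightarrow> x = 0) \<and>
       (\<forall>x y. p (x + y) \<le> p x + p y) \<and> (\<forall>c x. p (sc c x) = norm c * p x))"

definition every_subspace_contains_copy ::
    "('k::field \<Rightarrow> 'e::{ab_group_add,topological_space} \<Rightarrow> 'e) \<Rightarrow>
     ('k \<Rightarrow> 'g::{ab_group_add,topological_space} \<Rightarrow> 'g) \<Rightarrow> bool"
  where "every_subspace_contains_copy sE sG \<longleftrightarrow>
    (\<forall>M. inf_closed_subspace sE M \<longrightarrow>
      (\<exists>N. inf_closed_subspace sE N \<and> N \<subseteq> M \<and> isomorphic_subspaces sE N sG UNIV))"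

definition has_no_subspace_isomorphic_to ::
    "('k::field \<Rightarrow> 'f::{ab_group_add,topological_space} \<Rightarrow> 'f) \<Rightarrow>
     ('k \<Rightarrow> 'g::{ab_group_add,topological_space} \<Rightarrow> 'g) \<Rightarrow> bool"
  where "has_no_subspace_isomorphic_to sF sG \<longleftrightarrow>
    \<not> (\<exists>N. inf_closed_subspace sF N \<and> isomorphic_subspaces sF N sG UNIV)"

end

theory Submission
  imports Defs
begin

text \<open>The sufficiency part restricts the operator to a copy of \<open>G\<close>; the image is complete, hence
  closed.

  For the necessity part suppose that \<open>F\<close> contains a copy of \<open>G\<close>. Then \<open>G\<close> carries continuous norms
  \<open>p 0 \<le> p 1 \<le> \<dots>\<close> that define its topology, and \<open>G\<close> is not normable because \<open>F\<close> is Montel. Moreover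
  condition (1) makes every subspace of \<open>G\<close> contain a copy of \<open>G\<close>. These properties are
  contradictory: \<open>G\<close> has a subspace \<open>M\<close> whose tails \<open>Z n\<close>, of codimension at most \<open>n\<close>, satisfy
  \<open>p i \<le> \<eta> n * p (i + 1)\<close> for \<open>i \<le> n\<close>, with \<open>\<eta>\<close> decreasing as fast as we please. If \<open>\<eta>\<close> is chosen
  according to the equivalence constants of the norms on fixed \<open>(n + 1)\<close>-dimensional subspaces of
  \<open>G\<close>, then the image of such a subspace under an embedding of \<open>G\<close> into \<open>M\<close> meets \<open>Z n\<close>, which is
  impossible for large \<open>n\<close>.\<close>

section \<open>Norms on finite-dimensional subspaces\<close>

text \<open>The numbers \<open>\<eta> n\<close> are fixed before any embedding is known, whereas an
  embedding \<open>\<phi>\<close> brings its own data: \<open>p 0 x \<le> C * p k (\<phi> x)\<close>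
  and \<open>p (Suc k) (\<phi> x) \<le> C' * p r x\<close>, where \<open>C\<close> and
  \<open>C'\<close> may be taken at least 1. Finitely many data can be beaten in advance by a factor
  \<open>1 / (n + 1)\<close>. With \<open>D n\<close> comparing \<open>p n\<close> to
  \<open>p 0\<close> on the fixed subspace and \<open>\<eta> n = 1 / ((n + 1) * D n)\<close>, a
  vector \<open>v\<close> of it with \<open>\<phi> v\<close> in \<open>Z n\<close> satisfies
  \<open>p (Suc k) (\<phi> v) \<le> C * C' / (n + 1) * p (Suc k) (\<phi> v)\<close> for large
  \<open>n\<close>. The obstacle in building the tails: \<open>p i < \<eta> * p (i + 1)\<close> need
  not be a \<open>p i\<close>-open condition, so it could be lost when a vector is changed to meet
  the next one. Each estimate is therefore demanded on a \<open>p i\<close>-interior. Entering that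
  interior takes vectors that are small for \<open>p i\<close> and surrounded by a
  \<open>p i\<close>-ball on which \<open>p (i + 1)\<close> is large. Non-equivalence of the norms
  gives only the vectors; completeness gives the balls, after passing to a subsequence of the
  norms.\<close>

lemma bounded_scalars_convergent_subseq:
  fixes c :: "nat \<Rightarrow> 'k::real_or_complex"
  assumes "\<And>l. norm (c l) \<le> K"
  shows "\<exists>r a. strict_mono r \<and> (\<lambda>l. c (r l)) \<longlonglongrightarrow> a"
  using real_or_complex[where ?'a='k]
proof
  assume "\<forall>z::'k. \<exists>a. z = a *\<^sub>R 1"
  from choice[OF this] obtain f where f: "\<And>z::'k. z = f z *\<^sub>R 1" by blast
  have "\<bar>f (c l)\<bar> \<le> K" for l
  proof -
    have "norm (c l) = \<bar>f (c l)\<bar>" using arg_cong[OF f, of norm "c l"] by (simp only: norm_scaleR norm_one mult_1_right)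
    then show ?thesis using assms[of l] by simp
  qed
  then have "bounded (range (\<lambda>l. f (c l)))" unfolding bounded_iff by auto
  from bounded_imp_convergent_subsequence[OF this] obtain b r where
    r: "strict_mono r" "(\<lambda>l. f (c (r l))) \<longlonglongrightarrow> b" by (auto simp: o_def)
  then have "(\<lambda>l. f (c (r l)) *\<^sub>R (1::'k)) \<longlonglongrightarrow> b *\<^sub>R 1"
    by (intro tendsto_intros)
  then have "(\<lambda>l. c (r l)) \<longlonglongrightarrow> b *\<^sub>R 1" by (simp only: f[symmetric])
  then show ?thesis using r by blast
next
  assume "\<exists>i::'k. i * i = - 1 \<and> (\<forall>z. \<exists>a b. z = a *\<^sub>R 1 + b *\<^sub>R i) \<and>
        (\<forall>a b. norm (a *\<^sub>R 1 + b *\<^sub>R i) = sqrt (a\<^sup>2 + b\<^sup>2))"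
  then obtain i :: 'k where i: "\<And>z. \<exists>a b. z = a *\<^sub>R 1 + b *\<^sub>R i"
    "\<And>a b. norm (a *\<^sub>R 1 + b *\<^sub>R i) = sqrt (a\<^sup>2 + b\<^sup>2)" by blast
  have "\<forall>z. \<exists>q. z = fst q *\<^sub>R 1 + snd q *\<^sub>R i" using i(1) by (metis fst_conv snd_conv)
  from choice[OF this] obtain h where h: "\<And>z. z = fst (h z) *\<^sub>R 1 + snd (h z) *\<^sub>R i" by blast
  define f g where "f z = fst (h z)" and "g z = snd (h z)" for z
  have fg: "z = f z *\<^sub>R 1 + g z *\<^sub>R i" for z unfolding f_def g_def by (rule h)
  \<comment> \<open>The class only provides some \<open>i\<close>, so the identification with the
    real plane is built by hand; being isometric, it makes the Bolzano-Weierstrass theorem of the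
    plane available.\<close>
  have n: "norm (f z, g z) = norm z" for z
    using i(2)[of "f z" "g z"] by (simp only: norm_Pair real_norm_def power2_abs fg[symmetric])
  have "bounded (range (\<lambda>l. (f (c l), g (c l))))"
    unfolding bounded_iff using assms n by auto
  from bounded_imp_convergent_subsequence[OF this] obtain b r where
    r: "strict_mono r" "(\<lambda>l. (f (c (r l)), g (c (r l)))) \<longlonglongrightarrow> b" by (auto simp: o_def)
  have "(\<lambda>l. f (c (r l))) \<longlonglongrightarrow> fst b" "(\<lambda>l. g (c (r l))) \<longlonglongrightarrow> snd b"
    using tendsto_fst[OF r(2)] tendsto_snd[OF r(2)] by simp_all
  then have "(\<lambda>l. f (c (r l)) *\<^sub>R 1 + g (c (r l)) *\<^sub>R i) \<longlonglongrightarrow> fst b *\<^sub>R 1 + snd b *\<^sub>R i"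
    by (intro tendsto_intros)
  then have "(\<lambda>l. c (r l)) \<longlonglongrightarrow> fst b *\<^sub>R 1 + snd b *\<^sub>R i" by (simp only: fg[symmetric])
  then show ?thesis using r by blast
qed

locale seminorm = vector_space sc
  for sc :: "'k::real_or_complex \<Rightarrow> 'e::ab_group_add \<Rightarrow> 'e" (infixr \<open>\<cdot>\<close> 75) +
  fixes p :: "'e \<Rightarrow> real"
  assumes triangle: "p (x + y) \<le> p x + p y"
    and homogeneous: "p (c \<cdot> x) = norm c * p x"
begin

lemma zero [simp]: "p 0 = 0"
  using homogeneous[of 0 0] by simp

lemma minus [simp]: "p (- x) = p x"
  using homogeneous[of "-1" x] by (simp add: scale_minus_left)

lemma nonneg [simp]: "0 \<le> p x"
  using triangle[of x "- x"] by simp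

lemma triangle_diff: "p (x - y) \<le> p x + p y"
  using triangle[of x "- y"] by simp

lemma commute: "p (x - y) = p (y - x)"
  using minus[of "x - y"] by simp

lemma triangle_via: "p (x - z) \<le> p (x - y) + p (y - z)"
  using triangle[of "x - y" "y - z"] by simp

lemma reverse_triangle: "p x \<le> p y + p (x - y)"
  using triangle[of y "x - y"] by simp

lemma tendsto_seminorm:
  assumes "((\<lambda>l. p (x l - u)) \<longlongrightarrow> 0) F"
  shows "((\<lambda>l. p (x l)) \<longlongrightarrow> p u) F"
proof (rule LIM_zero_cancel, rule Lim_null_comparison[OF always_eventually assms], rule allI)
  show "norm (p (x l) - p u) \<le> p (x l - u)" for l
    using reverse_triangle[of "x l" u] reverse_triangle[of u "x l"] commute[of u "x l"] by simp
qed

end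

locale vector_norm = seminorm sc p
  for sc :: "'k::real_or_complex \<Rightarrow> 'e::ab_group_add \<Rightarrow> 'e" (infixr \<open>\<cdot>\<close> 75)
    and p :: "'e \<Rightarrow> real" +
  assumes definite: "p x = 0 \<Longrightarrow> x = 0"
begin

lemma eq_zero_iff [simp]: "p x = 0 \<longleftrightarrow> x = 0"
  using definite zero by blast

lemma pos_iff [simp]: "0 < p x \<longleftrightarrow> x \<noteq> 0"
  using nonneg[of x] eq_zero_iff[of x] by linarith

lemma limit_eqI:
  assumes "((\<lambda>l. p (x l - u)) \<longlongrightarrow> 0) F" "((\<lambda>l. p (x l - v)) \<longlongrightarrow> 0) F" "F \<noteq> bot"
  shows "u = v"
proof -
  have "((\<lambda>l. p (x l - u) + p (x l - v)) \<longlongrightarrow> 0) F"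
    using tendsto_add[OF assms(1,2)] by simp
  moreover have "p (u - v) \<le> p (x l - u) + p (x l - v)" for l
    using triangle_via[of u v "x l"] commute[of u "x l"] by simp
  ultimately have "p (u - v) \<le> 0"
    using tendsto_lowerbound[OF _ always_eventually assms(3)] by blast
  then show ?thesis using nonneg[of "u - v"] eq_zero_iff[of "u - v"] by simp
qed

text \<open>Induction on the spanning set. The coefficients of a new vector \<open>b\<close> outside
  \<open>span B\<close> stay bounded, hence converge along a subsequence, and the induction
  hypothesis treats the remainders.\<close>

lemma finite_span_compact:
  fixes x :: "nat \<Rightarrow> 'e"
  assumes "finite B" "\<And>l. x l \<in> span B" "\<And>l. p (x l) \<le> C"
  shows "\<exists>u\<in>span B. \<exists>r. strict_mono r \<and> (\<lambda>l. p (x (r l) - u)) \<longlonglongrightarrow> 0"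
  using assms
proof (induction B arbitrary: x C rule: finite_induct)
  case empty
  then have "x l = 0" for l by simp
  then show ?case by (simp add: exI[of strict_mono id, OF strict_mono_id])
next
  case (insert b B)
  show ?case
  proof (cases "b \<in> span B")
    case True
    then show ?thesis using insert.IH[of x C, OF _ insert.prems(2)] insert.prems(1) unfolding span_redundant[OF True] by blast
  next
    case False
    from insert.prems(1) have "\<forall>l. \<exists>c. x l - c \<cdot> b \<in> span B"
      by (simp add: span_breakdown_eq)
    then obtain c where c: "\<And>l. x l - c l \<cdot> b \<in> span B" by metis
    have "\<exists>K. \<forall>l. norm (c l) \<le> K"
    proof (rule ccontr)
      assume "\<not> ?thesis"
      then have "\<forall>n. \<exists>l. norm (c l) > real n + 1" by (meson not_le)
      then obtain g where g: "\<And>n. norm (c (g n)) > real n + 1" by metis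
      have g0: "c (g n) \<noteq> 0" for n using g[of n] by auto
      \<comment> \<open>Dividing by unbounded coefficients leaves vectors of \<open>span B\<close>
        that tend to \<open>- b\<close>. The induction hypothesis, used as closedness of
        \<open>span B\<close>, then puts \<open>b\<close> into \<open>span B\<close>.\<close>
      define y where "y n = inverse (c (g n)) \<cdot> (x (g n) - c (g n) \<cdot> b)" for n
      have yb: "y n + b = inverse (c (g n)) \<cdot> x (g n)" for n
        using g0 by (simp add: y_def scale_right_diff_distrib)
      have C: "0 \<le> C" using insert.prems(2)[of 0] nonneg[of "x 0"] by linarith
      have small: "p (y n + b) \<le> C * inverse (real (Suc n))" for n
      proof -
        have "p (y n + b) = inverse (norm (c (g n))) * p (x (g n))"
          by (simp add: yb homogeneous norm_inverse)
        also have "\<dots> \<le> inverse (real (Suc n)) * C"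
          using g[of n] insert.prems(2) C by (intro mult_mono le_imp_inverse_le) auto
        finally show ?thesis by (simp add: mult.commute)
      qed
      have "p (y n) \<le> C + p b" for n
      proof -
        have "p (y n) \<le> p (y n + b) + p b" using triangle_diff[of "y n + b" b] by simp
        also have "p (y n + b) \<le> C"
          using C by (intro order.trans[OF small[of n]] mult_left_le) (simp_all add: inverse_le_1_iff)
        finally show ?thesis by simp
      qed
      moreover have "y n \<in> span B" for n unfolding y_def by (intro span_scale c)
      ultimately obtain u r where u: "u \<in> span B" "strict_mono r" "(\<lambda>l. p (y (r l) - u)) \<longlonglongrightarrow> 0"
        using insert.IH by blast
      have "(\<lambda>n. p (y n + b)) \<longlonglongrightarrow> 0"
        by (rule tendsto_sandwich[OF _ _ tendsto_const
              tendsto_mult_right_zero[OF LIMSEQ_inverse_real_of_nat, where c=C]])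
           (use small in auto)
      from LIMSEQ_subseq_LIMSEQ[OF this u(2)] have "(\<lambda>n. p (y (r n) - (- b))) \<longlonglongrightarrow> 0"
        by (simp add: o_def)
      from limit_eqI[OF this u(3)] have "- b = u" by simp
      then have "b \<in> span B" using u(1) span_neg[of u B] by auto
      with False show False ..
    qed
    then obtain K where K: "\<And>l. norm (c l) \<le> K" by blast
    from bounded_scalars_convergent_subseq[of c K, OF this] obtain r a where
      r: "strict_mono r" "(\<lambda>l. c (r l)) \<longlonglongrightarrow> a" by blast
    have "p (x (r l) - c (r l) \<cdot> b) \<le> C + K * p b" for l
      using triangle_diff[of "x (r l)" "c (r l) \<cdot> b"] insert.prems(2)[of "r l"]
        mult_right_mono[OF K[of "r l"] nonneg[of b]] by (simp add: homogeneous)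
    with insert.IH[of "\<lambda>l. x (r l) - c (r l) \<cdot> b"] c obtain u s where
      u: "u \<in> span B" "strict_mono s" "(\<lambda>l. p (x (r (s l)) - c (r (s l)) \<cdot> b - u)) \<longlonglongrightarrow> 0"
      by blast
    have "(\<lambda>l. c (r (s l))) \<longlonglongrightarrow> a" using LIMSEQ_subseq_LIMSEQ[OF r(2) u(2)] by (simp add: o_def)
    then have "(\<lambda>l. c (r (s l)) - a) \<longlonglongrightarrow> 0" by (rule LIM_zero)
    then have ca: "(\<lambda>l. norm (c (r (s l)) - a) * p b) \<longlonglongrightarrow> 0"
      by (rule tendsto_mult_left_zero[OF tendsto_norm_zero])
    let ?v = "u + a \<cdot> b"
    have "p (x (r (s l)) - ?v) \<le> p (x (r (s l)) - c (r (s l)) \<cdot> b - u) + norm (c (r (s l)) - a) * p b" for l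
    proof -
      have "x (r (s l)) - ?v = (x (r (s l)) - c (r (s l)) \<cdot> b - u) + (c (r (s l)) - a) \<cdot> b"
        by (simp add: scale_left_diff_distrib)
      then show ?thesis
        using triangle[of "x (r (s l)) - c (r (s l)) \<cdot> b - u" "(c (r (s l)) - a) \<cdot> b"]
        by (simp only: homogeneous)
    qed
    then have "(\<lambda>l. p (x (r (s l)) - ?v)) \<longlonglongrightarrow> 0"
      by (intro tendsto_sandwich[OF _ _ tendsto_const tendsto_add_zero[OF u(3) ca]] always_eventually allI)
        simp_all
    moreover have "?v \<in> span (insert b B)"
      using u(1) span_mono[OF subset_insertI[of B b]] by (intro span_add span_scale) (auto intro: span_base)
    moreover have "strict_mono (r \<circ> s)" using r u strict_mono_o by blast
    ultimately show ?thesis by (auto intro!: bexI[of _ ?v] exI[of _ "r \<circ> s"])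
  qed
qed

lemma finite_span_closed:
  assumes "finite B" "\<And>e. e > 0 \<Longrightarrow> \<exists>y\<in>span B. p (x - y) < e"
  shows "x \<in> span B"
proof -
  have "\<forall>n. \<exists>y\<in>span B. p (x - y) < inverse (real (Suc n))" using assms(2) by simp
  then obtain y where y: "\<And>n. y n \<in> span B" "\<And>n. p (x - y n) < inverse (real (Suc n))" by metis
  have lim: "(\<lambda>n. p (y n - x)) \<longlonglongrightarrow> 0"
    by (rule tendsto_sandwich[OF _ _ tendsto_const LIMSEQ_inverse_real_of_nat])
       (use y(2) in \<open>auto intro!: always_eventually less_imp_le simp: commute[of _ x] simp del: of_nat_Suc\<close>)
  have "p (y n) \<le> p x + 1" for n
  proof -
    have "inverse (real (Suc n)) \<le> 1" by (simp add: inverse_le_1_iff)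
    then show ?thesis using reverse_triangle[of "y n" x] commute[of "y n" x] y(2)[of n] by linarith
  qed
  from finite_span_compact[of B y "p x + 1", OF assms(1) y(1) this] obtain u r where
    u: "u \<in> span B" "strict_mono r" "(\<lambda>l. p (y (r l) - u)) \<longlonglongrightarrow> 0" by blast
  have "(\<lambda>n. p (y (r n) - x)) \<longlonglongrightarrow> 0" using LIMSEQ_subseq_LIMSEQ[OF lim u(2)] by (simp add: o_def)
  from limit_eqI[OF this u(3) trivial_limit_sequentially] have "x = u" .
  with u show ?thesis by simp
qed

text \<open>If no constant works, there are vectors with \<open>p + q\<close> equal to 1 and
  \<open>p\<close> tending to 0; by compactness they have a limit that is both zero and
  nonzero.\<close>

lemma finite_span_dominates:
  assumes "finite B" "seminorm sc q"
  shows "\<exists>D\<ge>1. \<forall>x\<in>span B. q x \<le> D * p x"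
proof (rule ccontr)
  interpret q: seminorm sc q by fact
  \<comment> \<open>Compactness is applied to \<open>p + q\<close> and not to \<open>p\<close>: this
    way \<open>q\<close> converges along the subsequence too, and the limit keeps
    \<open>p u + q u = 1\<close>.\<close>
  interpret N: vector_norm sc "\<lambda>x. p x + q x"
  proof
    fix x y c
    show "p (x + y) + q (x + y) \<le> p x + q x + (p y + q y)"
      using triangle[of x y] q.triangle[of x y] by simp
    show "p (c \<cdot> x) + q (c \<cdot> x) = norm c * (p x + q x)"
      by (simp add: homogeneous q.homogeneous distrib_left)
    show "p x + q x = 0 \<Longrightarrow> x = 0"
      using nonneg[of x] q.nonneg[of x] definite[of x] by linarith
  qed
  assume "\<not> ?thesis"
  then have "\<forall>D\<ge>1. \<exists>x\<in>span B. q x > D * p x" by (meson not_le)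
  then have "\<forall>n. \<exists>x\<in>span B. q x > real (Suc n) * p x" by simp
  then obtain x where x: "\<And>n. x n \<in> span B" "\<And>n. q (x n) > real (Suc n) * p (x n)" by metis
  have pos: "0 < q (x n)" for n
  proof -
    have "0 \<le> real (Suc n) * p (x n)" by simp
    then show ?thesis using x(2)[of n] by linarith
  qed
  define t where "t n = p (x n) + q (x n)" for n
  have t: "t n > 0" for n using pos[of n] nonneg[of "x n"] unfolding t_def by linarith
  define y where "y n = of_real (inverse (t n)) \<cdot> x n" for n
  have N1: "p (y n) + q (y n) = 1" for n
  proof -
    have "p (y n) + q (y n) = inverse (t n) * t n"
      using t[of n] unfolding y_def homogeneous q.homogeneous norm_of_real t_def by (simp add: distrib_left)
    then show ?thesis using t[of n] by simp
  qed
  have y: "y n \<in> span B" for n unfolding y_def by (intro span_scale x)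
  have small: "p (y n) \<le> inverse (real (Suc n))" for n
  proof -
    have "real (Suc n) * p (y n) \<le> q (y n)"
      using mult_left_mono[OF less_imp_le[OF x(2)[of n]], of "inverse (t n)"] t[of n]
      by (simp add: y_def homogeneous q.homogeneous mult_ac)
    also have "\<dots> \<le> 1" using N1[of n] nonneg[of "y n"] by linarith
    finally show ?thesis by (simp add: field_simps)
  qed
  from N.finite_span_compact[of B y 1, OF assms(1) y eq_refl[OF N1]] obtain u r where
    u: "strict_mono r" "(\<lambda>l. p (y (r l) - u) + q (y (r l) - u)) \<longlonglongrightarrow> 0" by blast
  have "(\<lambda>l. p (y l)) \<longlonglongrightarrow> 0"
    by (rule tendsto_sandwich[OF _ _ tendsto_const LIMSEQ_inverse_real_of_nat]) (use small in auto)
  from LIMSEQ_subseq_LIMSEQ[OF this u(1)] have "(\<lambda>l. p (y (r l) - 0)) \<longlonglongrightarrow> 0" by (simp add: o_def)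
  moreover have "(\<lambda>l. p (y (r l) - u)) \<longlonglongrightarrow> 0"
    by (rule tendsto_sandwich[OF _ _ tendsto_const u(2)]) auto
  ultimately have "u = 0" by (intro limit_eqI[OF _ _ trivial_limit_sequentially, symmetric])
  moreover have "p u + q u = 1"
    using LIMSEQ_unique[OF N.tendsto_seminorm[OF u(2)], of 1] by (simp add: N1)
  ultimately show False by simp
qed

end

section \<open>Perturbation of finite-dimensional subspaces\<close>

context vector_norm
begin

text \<open>The type carries no topology here; each norm of a sequence will supply its own notion of
  openness.\<close>

definition p_open :: "'e set \<Rightarrow> bool" where
  "p_open A \<longleftrightarrow> (\<forall>u\<in>A. \<exists>e>0. \<forall>y. p (y - u) < e \<longrightarrow> y \<in> A)"

definition cone :: "'e set \<Rightarrow> bool" where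
  "cone A \<longleftrightarrow> (\<forall>c. \<forall>u\<in>A. c \<noteq> 0 \<longrightarrow> c \<cdot> u \<in> A)"

lemma p_open_eventually:
  assumes "p_open A" "u \<in> A" "((\<lambda>l. p (z l - u)) \<longlongrightarrow> 0) F"
  shows "\<forall>\<^sub>F l in F. z l \<in> A"
proof -
  from assms(1,2) obtain e where e: "e > 0" "\<And>y. p (y - u) < e \<Longrightarrow> y \<in> A"
    unfolding p_open_def by blast
  show ?thesis by (rule eventually_mono[OF order_tendstoD(2)[OF assms(3) e(1)] e(2)])
qed

text \<open>Normalising the failing pairs \<open>(x, a)\<close> by \<open>max (p x) (norm a) = 1\<close> makes them
  converge along a subsequence.\<close>

lemma failing_subsequence:
  assumes "finite B" "cone A"
    and "\<not> (\<forall>\<^sub>F l in sequentially. \<forall>x\<in>span B. \<forall>a. x \<noteq> 0 \<or> a \<noteq> 0 \<longrightarrow> x + a \<cdot> v l \<in> A)"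
  obtains r x a u b where "strict_mono r" "\<And>l. x l \<in> span B" "\<And>l. p (x l) \<le> 1" "\<And>l. norm (a l) \<le> 1"
    "\<And>l. x l + a l \<cdot> v (r l) \<notin> A" "u \<in> span B" "(\<lambda>l. p (x l - u)) \<longlonglongrightarrow> 0" "a \<longlonglongrightarrow> b"
    "u \<noteq> 0 \<or> b \<noteq> 0"
proof -
  obtain r :: "nat \<Rightarrow> nat" where r: "strict_mono r"
    "\<And>l. \<not> (\<forall>x\<in>span B. \<forall>a. x \<noteq> 0 \<or> a \<noteq> 0 \<longrightarrow> x + a \<cdot> v (r l) \<in> A)"
    using not_eventually_sequentiallyD[OF assms(3)] by blast
  have "\<forall>l. \<exists>x a. x \<in> span B \<and> max (p x) (norm a) = 1 \<and> x + a \<cdot> v (r l) \<notin> A"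
  proof
    fix l
    from r(2)[of l] obtain x a where xa: "x \<in> span B" "x \<noteq> 0 \<or> a \<noteq> 0" "x + a \<cdot> v (r l) \<notin> A"
      by blast
    define t where "t = max (p x) (norm a)"
    have t: "t > 0" using xa(2) unfolding t_def less_max_iff_disj by simp
    define c :: 'k where "c = of_real (inverse t)"
    have c: "c \<noteq> 0" "norm c = inverse t" using t unfolding c_def norm_of_real by simp_all
    have "c \<cdot> x + (c * a) \<cdot> v (r l) \<notin> A"
    proof
      assume "c \<cdot> x + (c * a) \<cdot> v (r l) \<in> A"
      then have "inverse c \<cdot> (c \<cdot> x + (c * a) \<cdot> v (r l)) \<in> A"
        using assms(2) c(1) unfolding cone_def by simp
      with xa(3) c(1) show False by (simp add: scale_right_distrib flip: mult.assoc)
    qed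
    moreover have "max (p (c \<cdot> x)) (norm (c * a)) = 1"
    proof -
      have "max (p (c \<cdot> x)) (norm (c * a)) = inverse t * max (p x) (norm a)"
        using t by (simp add: homogeneous norm_mult c(2) max_mult_distrib_left)
      then show ?thesis using t by (simp flip: t_def)
    qed
    ultimately show "\<exists>x a. x \<in> span B \<and> max (p x) (norm a) = 1 \<and> x + a \<cdot> v (r l) \<notin> A"
      using span_scale[OF xa(1)] by blast
  qed
  then obtain x a where xa: "\<And>l. x l \<in> span B" "\<And>l. max (p (x l)) (norm (a l)) = 1"
    "\<And>l. x l + a l \<cdot> v (r l) \<notin> A" by metis
  have le: "p (x l) \<le> 1" "norm (a l) \<le> 1" for l
    using xa(2)[of l] by linarith+
  obtain u s where u: "u \<in> span B" "strict_mono s" "(\<lambda>l. p (x (s l) - u)) \<longlonglongrightarrow> 0"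
    using finite_span_compact[of B x 1, OF assms(1) xa(1) le(1)] by blast
  obtain s' b where s': "strict_mono s'" "(\<lambda>l. a (s (s' l))) \<longlonglongrightarrow> b"
    using bounded_scalars_convergent_subseq[of "\<lambda>l. a (s l)" 1, OF le(2)] by blast
  have lim: "(\<lambda>l. p (x (s (s' l)) - u)) \<longlonglongrightarrow> 0"
    using LIMSEQ_subseq_LIMSEQ[OF u(3) s'(1)] by (simp add: o_def)
  have "(\<lambda>l. max (p (x (s (s' l)))) (norm (a (s (s' l))))) \<longlonglongrightarrow> max (p u) (norm b)"
    by (intro tendsto_max tendsto_seminorm lim tendsto_norm s')
  \<comment> \<open>The normalisation passes to the limit, which is what excludes the zero
    pair.\<close>
  then have "max (p u) (norm b) = 1" using LIMSEQ_unique[OF _ tendsto_const] unfolding xa(2) by fastforce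
  then have "u \<noteq> 0 \<or> b \<noteq> 0" by auto
  moreover have "strict_mono (\<lambda>l. r (s (s' l)))"
    using r(1) u(2) s'(1) by (simp add: strict_mono_def)
  ultimately show ?thesis
    using that[of "\<lambda>l. r (s (s' l))" "\<lambda>l. x (s (s' l))" "\<lambda>l. a (s (s' l))" u b] xa le lim s'(2) u(1)
    by blast
qed

lemma tendsto_combination:
  assumes "(\<lambda>l. p (x l - u)) \<longlonglongrightarrow> 0" "a \<longlonglongrightarrow> b" "(\<lambda>l. p (y l)) \<longlonglongrightarrow> 0"
  shows "(\<lambda>l. p (x l + a l \<cdot> (v + y l) - (u + b \<cdot> v))) \<longlonglongrightarrow> 0"
proof -
  have bound: "p (x l + a l \<cdot> (v + y l) - (u + b \<cdot> v))
      \<le> p (x l - u) + (norm (a l - b) * p v + norm (a l) * p (y l))" for l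
  proof -
    have "x l + a l \<cdot> (v + y l) - (u + b \<cdot> v) = (x l - u) + ((a l - b) \<cdot> v + a l \<cdot> y l)"
      by (simp add: scale_right_distrib scale_left_diff_distrib)
    then show ?thesis
      using triangle[of "x l - u" "(a l - b) \<cdot> v + a l \<cdot> y l"] triangle[of "(a l - b) \<cdot> v" "a l \<cdot> y l"]
      by (simp only: homogeneous)
  qed
  have "(\<lambda>l. p (x l - u) + (norm (a l - b) * p v + norm (a l) * p (y l))) \<longlonglongrightarrow> 0 + (norm (b - b) * p v + norm b * 0)"
    by (intro tendsto_add tendsto_mult tendsto_norm tendsto_diff tendsto_const assms)
  then have "(\<lambda>l. p (x l - u) + (norm (a l - b) * p v + norm (a l) * p (y l))) \<longlonglongrightarrow> 0" by simp
  from tendsto_sandwich[OF _ _ tendsto_const this] show ?thesis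
    using bound by (simp add: always_eventually)
qed

text \<open>Up to scaling the nonzero pairs \<open>(x, a)\<close> form a compact set, so membership
  of all \<open>x + a \<cdot> v\<close> in a \<open>p\<close>-open cone is stable under a uniformly
  small change of \<open>v\<close>.\<close>

lemma eventually_perturbed:
  assumes "finite B" "p_open A" "cone A"
    and "\<And>x a. x \<in> span B \<Longrightarrow> x \<noteq> 0 \<or> a \<noteq> 0 \<Longrightarrow> x + a \<cdot> v \<in> A"
    and "(\<lambda>l. p (y l)) \<longlonglongrightarrow> 0"
  shows "\<forall>\<^sub>F l in sequentially. \<forall>x\<in>span B. \<forall>a. x \<noteq> 0 \<or> a \<noteq> 0 \<longrightarrow> x + a \<cdot> (v + y l) \<in> A"
proof (rule ccontr)
  assume "\<not> ?thesis"
  from failing_subsequence[OF assms(1,3) this] obtain r x a u b where *: "strict_mono r"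
    "\<And>l. x l + a l \<cdot> (v + y (r l)) \<notin> A" "u \<in> span B" "(\<lambda>l. p (x l - u)) \<longlonglongrightarrow> 0" "a \<longlonglongrightarrow> b"
    "u \<noteq> 0 \<or> b \<noteq> 0" by metis
  have "(\<lambda>l. p (y (r l))) \<longlonglongrightarrow> 0" using LIMSEQ_subseq_LIMSEQ[OF assms(5) *(1)] by (simp add: o_def)
  from p_open_eventually[OF assms(2) assms(4)[OF *(3,6)] tendsto_combination[OF *(4,5) this]]
  show False using *(2) by simp
qed

text \<open>The \<open>p\<close>-interior of the set where \<open>p < \<eta> * q\<close>. That set
  itself need not be \<open>p\<close>-open, since \<open>q\<close> need not be
  \<open>p\<close>-continuous, and stability under perturbation requires openness.\<close>

definition dominated_interior :: "('e \<Rightarrow> real) \<Rightarrow> real \<Rightarrow> 'e set" where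
  "dominated_interior q \<eta> = {u. \<exists>e>0. \<forall>y. p (y - u) < e \<longrightarrow> p y < \<eta> * q y}"

lemma dominated_interior_less: "u \<in> dominated_interior q \<eta> \<Longrightarrow> p u < \<eta> * q u"
  unfolding dominated_interior_def by force

lemma p_open_dominated_interior: "p_open (dominated_interior q \<eta>)"
  unfolding p_open_def
proof
  fix u assume "u \<in> dominated_interior q \<eta>"
  then obtain e where e: "e > 0" "\<And>y. p (y - u) < e \<Longrightarrow> p y < \<eta> * q y"
    unfolding dominated_interior_def by blast
  have "y \<in> dominated_interior q \<eta>" if y: "p (y - u) < e / 2" for y
    unfolding dominated_interior_def
  proof (intro CollectI exI[of _ "e / 2"] conjI allI impI)
    fix w assume "p (w - y) < e / 2"
    then have "p (w - u) < e" using triangle_via[of w u y] y by linarith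
    then show "p w < \<eta> * q w" by (rule e(2))
  qed (use e in simp)
  then show "\<exists>e>0. \<forall>y. p (y - u) < e \<longrightarrow> y \<in> dominated_interior q \<eta>"
    using e(1) half_gt_zero by blast
qed

lemma cone_dominated_interior:
  assumes "seminorm sc q"
  shows "cone (dominated_interior q \<eta>)"
  unfolding cone_def
proof (intro allI ballI impI)
  interpret q: seminorm sc q by fact
  fix c :: 'k and u assume "u \<in> dominated_interior q \<eta>" and c: "c \<noteq> 0"
  then obtain e where e: "e > 0" "\<And>y. p (y - u) < e \<Longrightarrow> p y < \<eta> * q y"
    unfolding dominated_interior_def by blast
  show "c \<cdot> u \<in> dominated_interior q \<eta>"
    unfolding dominated_interior_def
  proof (intro CollectI exI[of _ "norm c * e"] conjI allI impI)
    show "0 < norm c * e" using c e by simp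
    fix y assume y: "p (y - c \<cdot> u) < norm c * e"
    have eq: "y - c \<cdot> u = c \<cdot> (inverse c \<cdot> y - u)" using c by (simp add: scale_right_diff_distrib)
    have "p (inverse c \<cdot> y - u) < e"
      using y c unfolding eq homogeneous by simp
    from e(2)[OF this] have "inverse (norm c) * p y < inverse (norm c) * (\<eta> * q y)"
      by (simp add: homogeneous q.homogeneous norm_inverse mult_ac)
    then show "p y < \<eta> * q y" using c by (simp add: mult_less_cancel_left_pos)
  qed
qed

text \<open>Here \<open>q\<close> is large on a whole \<open>p\<close>-neighbourhood of \<open>y l\<close>, although \<open>p (y l)\<close> tends to 0;
  this forces the coefficients of a failing sequence to tend to 0.\<close>

lemma eventually_extends:
  assumes "finite B" "seminorm sc q" "\<eta> > 0"
    and sub: "\<And>x. x \<in> span B \<Longrightarrow> x \<noteq> 0 \<Longrightarrow> x \<in> dominated_interior q \<eta>"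
    and small: "(\<lambda>l. p (y l)) \<longlonglongrightarrow> 0"
    and large: "\<And>l. \<exists>e>0. \<forall>w. p (w - y l) < e \<longrightarrow> real l < q w"
  shows "\<forall>\<^sub>F l in sequentially. \<forall>x\<in>span B. \<forall>a. x \<noteq> 0 \<or> a \<noteq> 0 \<longrightarrow>
    x + a \<cdot> (v + y l) \<in> dominated_interior q \<eta>"
proof (rule ccontr)
  interpret q: seminorm sc q by fact
  assume "\<not> ?thesis"
  from failing_subsequence[OF assms(1) cone_dominated_interior[OF assms(2)] this]
  obtain r x a u b where *: "strict_mono r"
    "\<And>l. x l + a l \<cdot> (v + y (r l)) \<notin> dominated_interior q \<eta>" "u \<in> span B"
    "(\<lambda>l. p (x l - u)) \<longlonglongrightarrow> 0" "a \<longlonglongrightarrow> b" "u \<noteq> 0 \<or> b \<noteq> 0"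
    "\<And>l. x l \<in> span B" "\<And>l. p (x l) \<le> 1" "\<And>l. norm (a l) \<le> 1" by metis
  have small': "(\<lambda>l. p (y (r l))) \<longlonglongrightarrow> 0"
    using LIMSEQ_subseq_LIMSEQ[OF small *(1)] by (simp add: o_def)
  show False
  proof (cases "b = 0")
    case True
    \<comment> \<open>The limit is now \<open>u\<close> alone, a nonzero vector of
      \<open>span B\<close>, so openness at \<open>u\<close> suffices.\<close>
    with *(6) have "u \<in> dominated_interior q \<eta>" using sub[OF *(3)] by blast
    then have "u + b \<cdot> v \<in> dominated_interior q \<eta>" using True by simp
    from p_open_eventually[OF p_open_dominated_interior this tendsto_combination[OF *(4,5) small']]
    show False using *(2) by simp
  next
    case False
    obtain D where D: "D \<ge> 1" "\<And>x. x \<in> span B \<Longrightarrow> q x \<le> D * p x"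
      using finite_span_dominates[OF assms(1,2)] by blast
    have "norm b / 2 < norm b" using False by simp
    from order_tendstoD(1)[OF tendsto_norm[OF *(5)] this]
    have ev1: "\<forall>\<^sub>F l in sequentially. norm b / 2 < norm (a l)" .
    have ev2: "\<forall>\<^sub>F l in sequentially. p (y (r l)) < 1" using order_tendstoD(2)[OF small'] by simp
    \<comment> \<open>Chosen so that \<open>norm (a l) * H\<close>, being at least
      \<open>norm b / 2 * H\<close>, leaves \<open>(3 + p v) / \<eta>\<close> after the
      contributions of \<open>x l\<close> (at most \<open>D\<close>) and of \<open>v\<close> to
      \<open>q\<close> are subtracted. The 3 accounts for \<open>p (x l)\<close>,
      \<open>p (y (r l))\<close> and the distance to \<open>w\<close> below, each at most 1.\<close>
    define H where "H = (D + q v + (3 + p v) / \<eta>) / (norm b / 2)"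
    obtain l0 :: nat where l0: "H < real l0" using reals_Archimedean2 by blast
    have "\<forall>\<^sub>F l in sequentially. l0 \<le> l \<and> norm b / 2 < norm (a l) \<and> p (y (r l)) < 1"
      using eventually_ge_at_top[of l0] ev1 ev2 by eventually_elim simp
    then obtain l where l: "l0 \<le> l" "norm b / 2 < norm (a l)" "p (y (r l)) < 1"
      by (auto simp: eventually_sequentially)
    have Hl: "H < real (r l)" using l0 l(1) seq_suble[OF *(1), of l] by simp
    have al: "a l \<noteq> 0" using l(2) by auto
    obtain e where e: "e > 0" "\<And>w. p (w - y (r l)) < e \<Longrightarrow> real (r l) < q w" using large by blast
    let ?z = "x l + a l \<cdot> (v + y (r l))"
    \<comment> \<open>The radius does two jobs: \<open>norm (a l) * e\<close> carries
      \<open>w\<close>, after division by \<open>a l\<close>, into the \<open>p\<close>-ball around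
      \<open>y (r l)\<close> where \<open>q\<close> is large, and the bound 1 keeps
      \<open>p w\<close> below \<open>3 + p v\<close>.\<close>
    have "?z \<in> dominated_interior q \<eta>"
      unfolding dominated_interior_def
    proof (intro CollectI exI[of _ "min 1 (norm (a l) * e)"] conjI allI impI)
      show "0 < min 1 (norm (a l) * e)" using al e(1) by simp
      fix w assume w: "p (w - ?z) < min 1 (norm (a l) * e)"
      define h where "h = inverse (a l) \<cdot> (w - x l) - v"
      have wh: "w = x l + a l \<cdot> (v + h)" using al by (simp add: h_def)
      have "p (w - ?z) = norm (a l) * p (h - y (r l))"
        unfolding homogeneous[symmetric] wh by (simp add: scale_right_distrib scale_right_diff_distrib)
      then have "p (h - y (r l)) < e" using w al by simp
      then have qh: "real (r l) < q h" by (rule e(2))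
      have "norm (a l) * q h = q (w - (x l + a l \<cdot> v))"
        unfolding q.homogeneous[symmetric] wh by (simp add: scale_right_distrib)
      also have "\<dots> \<le> q w + (q (x l) + norm (a l) * q v)"
        using q.triangle_diff[of w "x l + a l \<cdot> v"] q.triangle[of "x l" "a l \<cdot> v"]
        by (simp add: q.homogeneous)
      also have "q (x l) \<le> D" using D(2)[OF *(7)[of l]] mult_left_mono[OF *(8)[of l], of D] D(1) by linarith
      also have "norm (a l) * q v \<le> q v" using *(9)[of l] by (simp add: mult_left_le_one_le)
      finally have upper: "norm (a l) * q h \<le> q w + (D + q v)" by simp
      have H0: "0 \<le> H" using D(1) assms(3) by (simp add: H_def)
      have "D + q v + (3 + p v) / \<eta> = norm b / 2 * H" using False by (simp add: H_def)
      also have "\<dots> \<le> norm (a l) * H" using l(2) H0 by (intro mult_right_mono) auto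
      also have "\<dots> < norm (a l) * q h" using Hl qh al by simp
      finally have "(3 + p v) / \<eta> < q w" using upper by linarith
      then have "3 + p v < \<eta> * q w" using assms(3) by (simp add: field_simps)
      moreover have "p w \<le> 3 + p v"
      proof -
        have "p w \<le> p ?z + p (w - ?z)" by (rule reverse_triangle)
        also have "p ?z \<le> p (x l) + norm (a l) * (p v + p (y (r l)))"
          using triangle[of "x l" "a l \<cdot> (v + y (r l))"] mult_left_mono[OF triangle[of v "y (r l)"], of "norm (a l)"]
          by (simp add: homogeneous)
        also have "norm (a l) * (p v + p (y (r l))) \<le> p v + p (y (r l))"
          using *(9)[of l] by (simp add: mult_left_le_one_le)
        finally show ?thesis using w *(8)[of l] l(3) by simp
      qed
      ultimately show "p w < \<eta> * q w" by linarith
    qed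
    with *(2) show False by blast
  qed
qed

end

section \<open>Increasing sequences of norms\<close>

text \<open>A complete metrizable locally convex space presented by norms only. Without a topology
  on the type, each single norm and each subsequence of the norms can be treated on the same
  footing.\<close>

locale graded_norms = vector_space sc
  for sc :: "'k::real_or_complex \<Rightarrow> 'e::ab_group_add \<Rightarrow> 'e" (infixr \<open>\<cdot>\<close> 75) +
  fixes p :: "nat \<Rightarrow> 'e \<Rightarrow> real"
  assumes norms: "vector_norm sc (p k)"
    and increasing: "p k x \<le> p (Suc k) x"
    and complete: "(\<And>k e. e > 0 \<Longrightarrow> \<exists>N. \<forall>m\<ge>N. \<forall>n\<ge>N. p k (s m - s n) < e) \<Longrightarrow>
      \<exists>u. \<forall>k. (\<lambda>n. p k (s n - u)) \<longlonglongrightarrow> 0"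
begin

sublocale vector_norm sc "p k" for k
  by (rule norms)

lemma mono: "i \<le> j \<Longrightarrow> p i x \<le> p j x"
  by (rule lift_Suc_mono_le[of "\<lambda>k. p k x"]) (rule increasing)

text \<open>The open mapping argument for the identity from the graded space to the space normed by
  \<open>p k\<close>: if the balls of every \<open>p q\<close> had \<open>p k\<close>-closures that are \<open>p k\<close>-neighbourhoods of 0, then
  successive approximation would make \<open>p k\<close> dominate all the norms.\<close>

lemma exists_spread:
  assumes "\<exists>q. \<forall>C. \<exists>x. C * p k x < p q x"
  shows "\<exists>q. \<forall>d>0. \<forall>H. \<exists>y. p k y < d \<and> (\<exists>e>0. \<forall>w. p k (w - y) < e \<longrightarrow> H < p q w)"
proof (rule ccontr)
  assume "\<not> ?thesis"
  then have "\<forall>q. \<exists>d H. d > 0 \<and> (\<forall>y. p k y < d \<longrightarrow> (\<forall>e>0. \<exists>w. p k (w - y) < e \<and> p q w \<le> H))"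
    by (meson not_le)
  then obtain d H where dH: "\<And>q. d q > 0"
    "\<And>q y e. p k y < d q \<Longrightarrow> e > 0 \<Longrightarrow> \<exists>w. p k (w - y) < e \<and> p q w \<le> H q"
    by metis
  \<comment> \<open>In \<open>approx\<close> a vector is rescaled to \<open>p k\<close>-length
    \<open>d q / 2\<close>, and the factor \<open>2 / d q\<close> undoes this. The lower bound 1
    makes \<open>C\<close> harmless as a divisor and lets bounds on
    \<open>C (q + n) * p k (f n)\<close> pass to \<open>p k (f n)\<close>.\<close>
  define C where "C q = max 1 (H q * (2 / d q))" for q
  have C1: "1 \<le> C q" for q by (simp add: C_def)
  \<comment> \<open>The density statement for one ball, rescaled: every \<open>y\<close> splits into
    a part controlled in \<open>p q\<close> and an error \<open>w\<close> as small in
    \<open>p k\<close> as desired.\<close>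
  have approx: "\<exists>w. p k w < e \<and> p q (y - w) \<le> C q * p k y" if "e > 0" for q y e
  proof (cases "y = 0")
    case True
    then show ?thesis using that by (intro exI[of _ 0]) simp
  next
    case False
    then have py: "p k y > 0" by simp
    define t where "t = d q / (2 * p k y)"
    have t: "t > 0" using py dH(1)[of q] by (simp add: t_def)
    define c :: 'k where "c = of_real t"
    have c: "norm c = t" "c \<noteq> 0" using t unfolding c_def norm_of_real by simp_all
    have "p k (c \<cdot> y) < d q" using py dH(1)[of q] by (simp add: homogeneous c t_def)
    from dH(2)[OF this mult_pos_pos[OF t that]] obtain w where w: "p k (w - c \<cdot> y) < t * e" "p q w \<le> H q"
      by blast
    let ?w = "y - inverse c \<cdot> w"
    have "c \<cdot> ?w = c \<cdot> y - w" using c by (simp add: scale_right_diff_distrib)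
    then have "t * p k ?w < t * e"
      using w(1) commute[of k w "c \<cdot> y"] homogeneous[of k c ?w] c by simp
    then have "p k ?w < e" using t by simp
    moreover have "p q (y - ?w) \<le> C q * p k y"
    proof -
      have "p q (y - ?w) = inverse t * p q w" by (simp add: homogeneous norm_inverse c)
      also have "\<dots> \<le> inverse t * H q" using w(2) t by simp
      also have "\<dots> = (H q * (2 / d q)) * p k y" using py dH(1)[of q] by (simp add: t_def field_simps)
      also have "\<dots> \<le> C q * p k y" using py by (intro mult_right_mono) (auto simp: C_def)
      finally show ?thesis .
    qed
    ultimately show ?thesis by blast
  qed
  have dominated: "p q y \<le> 2 * C q * p k y" for q y
  proof (cases "y = 0")
    case False
    let ?P = "p k y"
    define K where "K = C q * ?P"
    have K: "0 \<le> K" "?P \<le> K" "0 < K"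
      using False C1[of q] mult_right_mono[OF C1[of q] nonneg[of k y]] by (simp_all add: K_def)
    \<comment> \<open>Here \<open>f n\<close> is what remains of \<open>y\<close> after
      \<open>n\<close> corrections. The correction number \<open>n\<close> is controlled in
      \<open>p (q + n)\<close>, so that the corrections are summable in every norm; each new error
      is made small enough to absorb its own constant \<open>C (q + Suc n)\<close>.\<close>
    have "\<exists>f. \<forall>n. ((n = 0 \<longrightarrow> f n = y) \<and> C (q + n) * p k (f n) \<le> K / 2 ^ n) \<and>
      p (q + n) (f n - f (Suc n)) \<le> C (q + n) * p k (f n)"
    proof (rule dependent_nat_choice)
      show "\<exists>x. (0 = (0::nat) \<longrightarrow> x = y) \<and> C (q + 0) * p k x \<le> K / 2 ^ 0"
        by (simp add: K_def)
    next
      fix x n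
      show "\<exists>w. ((Suc n = 0 \<longrightarrow> w = y) \<and> C (q + Suc n) * p k w \<le> K / 2 ^ Suc n) \<and>
        p (q + n) (x - w) \<le> C (q + n) * p k x"
      proof -
        have "0 < K / 2 ^ Suc n / C (q + Suc n)" using C1[of "q + Suc n"] K(3) by simp
        from approx[OF this, of "q + n" x] obtain w where
          w: "p k w < K / 2 ^ Suc n / C (q + Suc n)" "p (q + n) (x - w) \<le> C (q + n) * p k x" by blast
        have "C (q + Suc n) * p k w \<le> K / 2 ^ Suc n"
          using w(1) C1[of "q + Suc n"] by (simp add: field_simps)
        then show ?thesis using w(2) by blast
      qed
    qed
    then obtain f where f: "f 0 = y" "\<And>n. C (q + n) * p k (f n) \<le> K / 2 ^ n"
      "\<And>n. p (q + n) (f n - f (Suc n)) \<le> C (q + n) * p k (f n)" by metis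
    have step: "p t (f n - f (Suc n)) \<le> K / 2 ^ n" if "t \<le> q + n" for t n
      using mono[OF that, of "f n - f (Suc n)"] f(2)[of n] f(3)[of n] by linarith
    have tail: "p t (f n - f (n + i)) \<le> 2 * K / 2 ^ n - 2 * K / 2 ^ (n + i)" if "t \<le> q + n" for t n i
    proof (induction i)
      case (Suc i)
      have "p t (f n - f (n + Suc i)) \<le> p t (f n - f (n + i)) + p t (f (n + i) - f (Suc (n + i)))"
        using triangle_via[of t "f n" "f (n + Suc i)" "f (n + i)"] by simp
      also have "\<dots> \<le> (2 * K / 2 ^ n - 2 * K / 2 ^ (n + i)) + K / 2 ^ (n + i)"
        using that by (intro add_mono Suc step) simp
      also have "\<dots> = 2 * K / 2 ^ n - 2 * K / 2 ^ (n + Suc i)" by simp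
      finally show ?case .
    qed simp
    have null: "(\<lambda>n. a / 2 ^ n) \<longlonglongrightarrow> 0" for a :: real
      using tendsto_mult_right_zero[OF LIMSEQ_power_zero[of "1/2::real"], where c=a] by (simp add: power_divide)
    have tail': "p t (f n - f m) \<le> 2 * K / 2 ^ n" if "t \<le> n" "n \<le> m" for t n m
    proof -
      have "0 \<le> 2 * K / 2 ^ m" using K(1) by simp
      then show ?thesis using tail[of t n "m - n"] that by simp
    qed
    have cauchy: "\<exists>N. \<forall>m\<ge>N. \<forall>n\<ge>N. p t (f m - f n) < e" if "e > 0" for t e
    proof -
      have "\<forall>\<^sub>F n in sequentially. 4 * K / 2 ^ n < e \<and> t \<le> n"
        using order_tendstoD(2)[OF null that] eventually_ge_at_top by (rule eventually_conj)
      then obtain N where N: "4 * K / 2 ^ N < e" "t \<le> N" by (auto simp: eventually_sequentially)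
      have "p t (f m - f n) < e" if "N \<le> m" "N \<le> n" for m n
        using triangle_via[of t "f m" "f n" "f N"] commute[of t "f m" "f N"]
          tail'[OF N(2) that(1)] tail'[OF N(2) that(2)] N(1) by simp
      then show ?thesis by blast
    qed
    from complete[OF this] obtain u where u: "\<And>t. (\<lambda>n. p t (f n - u)) \<longlonglongrightarrow> 0" by blast
    have "p k (f n) \<le> K / 2 ^ n" for n
      using f(2)[of n] mult_right_mono[OF C1[of "q + n"] nonneg[of k "f n"]] by simp
    then have "(\<lambda>n. p k (f n - 0)) \<longlonglongrightarrow> 0"
      by (intro tendsto_sandwich[OF _ _ tendsto_const null[of K]] always_eventually allI) simp_all
    \<comment> \<open>Definiteness of \<open>p k\<close> identifies the limit. The errors therefore
      vanish in \<open>p q\<close> as well, although the construction bounded only their differences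
      in that norm.\<close>
    from limit_eqI[OF u this trivial_limit_sequentially] have "u = 0" .
    then have "(\<lambda>n. 2 * K + p q (f n)) \<longlonglongrightarrow> 2 * K + 0" using u[of q] by (intro tendsto_add tendsto_const) simp
    moreover have "p q y \<le> 2 * K + p q (f n)" for n
    proof -
      have "p q (y - f n) \<le> 2 * K"
      proof -
        have "0 \<le> 2 * K / 2 ^ n" using K(1) by simp
        then show ?thesis using tail[of q 0 n] f(1) by simp
      qed
      then show ?thesis using reverse_triangle[of q y "f n"] by linarith
    qed
    ultimately have "p q y \<le> 2 * K + 0"
      by (intro tendsto_lowerbound[OF _ always_eventually trivial_limit_sequentially]) blast+
    then show ?thesis by (simp add: K_def)
  qed simp
  from assms obtain q where "\<And>C. \<exists>x. C * p k x < p q x" by blast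
  with dominated[of q] show False by (meson not_less)
qed

end

section \<open>Closed subspaces of a graded space, finite codimension\<close>

context graded_norms
begin

text \<open>Closure in the topology of all the norms; one norm at a time suffices because the norms
  increase.\<close>

definition cl :: "'e set \<Rightarrow> 'e set" where
  "cl S = {u. \<forall>k. \<forall>e>0. \<exists>s\<in>S. p k (u - s) < e}"

lemma cl_increasing: "S \<subseteq> cl S"
  unfolding cl_def by force

lemma cl_mono: "S \<subseteq> T \<Longrightarrow> cl S \<subseteq> cl T"
  unfolding cl_def by blast

lemma cl_cl: "cl (cl S) = cl S"
proof
  show "cl (cl S) \<subseteq> cl S"
  proof
    fix u assume u: "u \<in> cl (cl S)"
    have "\<exists>s\<in>S. p k (u - s) < e" if e: "e > 0" for k e
    proof -
      from e have e2: "0 < e / 2" by simp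
      with u obtain v where v: "v \<in> cl S" "p k (u - v) < e / 2"
        unfolding cl_def[of "cl S"] by blast
      then obtain s where s: "s \<in> S" "p k (v - s) < e / 2"
        using e2 unfolding cl_def[of S] by blast
      have "p k (u - s) < e" using triangle_via[of k u s v] v(2) s(2) by linarith
      with s show ?thesis by blast
    qed
    then show "u \<in> cl S" unfolding cl_def by blast
  qed
qed (rule cl_increasing)

lemma cl_sequence:
  assumes "u \<in> cl S"
  obtains s where "\<And>l::nat. s l \<in> S" "\<And>k. (\<lambda>l. p k (s l - u)) \<longlonglongrightarrow> 0"
proof -
  have "\<forall>l. \<exists>s\<in>S. p l (u - s) < inverse (real (Suc l))"
    using assms unfolding cl_def by simp
  then obtain s where s: "\<And>l. s l \<in> S" "\<And>l. p l (u - s l) < inverse (real (Suc l))" by metis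
  have "(\<lambda>l. p k (s l - u)) \<longlonglongrightarrow> 0" for k
  proof (rule tendsto_sandwich[OF _ _ tendsto_const LIMSEQ_inverse_real_of_nat])
    show "\<forall>\<^sub>F l in sequentially. p k (s l - u) \<le> inverse (real (Suc l))"
      using eventually_ge_at_top[of k]
    proof eventually_elim
      case (elim l)
      show ?case using mono[OF elim, of "s l - u"] s(2)[of l] commute[of l u "s l"] by linarith
    qed
  qed simp
  with s(1) show ?thesis using that by blast
qed

lemma cl_limit:
  assumes "\<And>l::nat. s l \<in> S" "\<And>k. (\<lambda>l. p k (s l - u)) \<longlonglongrightarrow> 0"
  shows "u \<in> cl S"
proof -
  have "\<exists>s\<in>S. p k (u - s) < e" if "e > 0" for k e
  proof -
    from order_tendstoD(2)[OF assms(2) that] obtain l where "p k (s l - u) < e"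
      by (auto simp: eventually_sequentially)
    then show ?thesis using assms(1)[of l] commute[of k u "s l"] by metis
  qed
  then show ?thesis unfolding cl_def by blast
qed

lemma tendsto_sum_diff:
  assumes "(\<lambda>l. p k (x l - u)) \<longlonglongrightarrow> 0" "(\<lambda>l. p k (y l - v)) \<longlonglongrightarrow> 0"
  shows "(\<lambda>l. p k (x l + y l - (u + v))) \<longlonglongrightarrow> 0"
proof (rule tendsto_sandwich[OF _ _ tendsto_const tendsto_add_zero[OF assms]])
  have "p k (x l + y l - (u + v)) \<le> p k (x l - u) + p k (y l - v)" for l
    using triangle[of k "x l - u" "y l - v"] by (simp add: algebra_simps)
  then show "\<forall>\<^sub>F l in sequentially. p k (x l + y l - (u + v)) \<le> p k (x l - u) + p k (y l - v)"
    by simp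
qed simp

lemma tendsto_scaled:
  assumes "c \<longlonglongrightarrow> a" "(\<lambda>l. p k (x l - u)) \<longlonglongrightarrow> 0"
  shows "(\<lambda>l. p k (c l \<cdot> x l - a \<cdot> u)) \<longlonglongrightarrow> 0"
proof -
  have "(\<lambda>l. norm (c l - a) * p k u + norm (c l) * p k (x l - u)) \<longlonglongrightarrow> norm (a - a) * p k u + norm a * 0"
    by (intro tendsto_add tendsto_mult tendsto_norm tendsto_diff tendsto_const assms)
  then have lim: "(\<lambda>l. norm (c l - a) * p k u + norm (c l) * p k (x l - u)) \<longlonglongrightarrow> 0" by simp
  have "p k (c l \<cdot> x l - a \<cdot> u) \<le> norm (c l - a) * p k u + norm (c l) * p k (x l - u)" for l
  proof -
    have "c l \<cdot> x l - a \<cdot> u = (c l - a) \<cdot> u + c l \<cdot> (x l - u)"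
      by (simp add: scale_right_diff_distrib scale_left_diff_distrib)
    then show ?thesis
      using triangle[of k "(c l - a) \<cdot> u" "c l \<cdot> (x l - u)"] by (simp only: homogeneous)
  qed
  then show ?thesis
    by (intro tendsto_sandwich[OF _ _ tendsto_const lim] always_eventually allI) simp_all
qed

lemma subspace_cl:
  assumes "subspace S"
  shows "subspace (cl S)"
proof (rule subspaceI)
  show "0 \<in> cl S" using cl_increasing subspace_0[OF assms] by blast
next
  fix u v assume "u \<in> cl S" "v \<in> cl S"
  then obtain x y where "\<And>l::nat. x l \<in> S" "\<And>k. (\<lambda>l. p k (x l - u)) \<longlonglongrightarrow> 0"
    "\<And>l::nat. y l \<in> S" "\<And>k. (\<lambda>l. p k (y l - v)) \<longlonglongrightarrow> 0" by (metis cl_sequence)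
  then show "u + v \<in> cl S"
    by (intro cl_limit[of "\<lambda>l. x l + y l"] tendsto_sum_diff subspace_add[OF assms])
next
  fix c u assume "u \<in> cl S"
  then obtain x where "\<And>l::nat. x l \<in> S" "\<And>k. (\<lambda>l. p k (x l - u)) \<longlonglongrightarrow> 0" by (metis cl_sequence)
  then show "c \<cdot> u \<in> cl S"
    by (intro cl_limit[of "\<lambda>l. c \<cdot> x l"] tendsto_scaled tendsto_const subspace_scale[OF assms])
qed

text \<open>Adding one dimension to a closed subspace leaves it closed. If \<open>b\<close> is
  outside \<open>Z\<close>, it has positive distance from \<open>Z\<close> in some norm; this bounds
  the coefficients of \<open>b\<close> along a convergent sequence, so a subsequence of them
  converges.\<close>

lemma cl_span_insert:
  assumes Z: "subspace Z" "cl Z \<subseteq> Z" and u: "u \<in> cl (span (insert b Z))"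
  shows "\<exists>c. u - c \<cdot> b \<in> Z"
proof (cases "b \<in> Z")
  case True
  then have "span (insert b Z) = Z" using span_eq_iff[of Z] Z(1) by (simp add: insert_absorb)
  then show ?thesis using u Z(2) by (auto intro!: exI[of _ 0])
next
  case False
  then have "b \<notin> cl Z" using Z(2) by blast
  then obtain k e where ke: "e > 0" "\<And>z. z \<in> Z \<Longrightarrow> e \<le> p k (b - z)"
    unfolding cl_def by (auto simp: not_less)
  from u obtain w where w: "\<And>l::nat. w l \<in> span (insert b Z)" "\<And>k. (\<lambda>l. p k (w l - u)) \<longlonglongrightarrow> 0"
    by (metis cl_sequence)
  have eq: "span Z = Z" using Z(1) by simp
  have "\<forall>l. \<exists>c. w l - c \<cdot> b \<in> Z" using w(1) unfolding span_breakdown_eq eq by blast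
  then obtain c where c: "\<And>l. w l - c l \<cdot> b \<in> Z" by metis
  have cw: "norm (c l) * e \<le> p k (w l)" for l
  proof (cases "c l = 0")
    case False
    have "b - (- inverse (c l) \<cdot> (w l - c l \<cdot> b)) = inverse (c l) \<cdot> w l"
      using False by (simp add: scale_right_diff_distrib)
    then have "e \<le> inverse (norm (c l)) * p k (w l)"
      using ke(2)[OF subspace_scale[OF Z(1) c[of l], of "- inverse (c l)"]]
      by (simp add: homogeneous norm_inverse)
    then show ?thesis using False by (simp add: field_simps)
  qed simp
  obtain K where K: "\<And>l. p k (w l) \<le> K"
    using convergent_imp_Bseq[OF convergentI[OF tendsto_seminorm[OF w(2)[of k]]]]
    unfolding Bseq_def by auto
  have "norm (c l) \<le> K / e" for l using cw[of l] K[of l] ke(1) by (simp add: field_simps)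
  from bounded_scalars_convergent_subseq[of c "K / e", OF this] obtain r a where
    r: "strict_mono r" "(\<lambda>l. c (r l)) \<longlonglongrightarrow> a" by blast
  have wr: "(\<lambda>l. p k (w (r l) - u)) \<longlonglongrightarrow> 0" for k
    using LIMSEQ_subseq_LIMSEQ[OF w(2)[of k] r(1)] by (simp add: o_def)
  have "(\<lambda>l. - c (r l)) \<longlonglongrightarrow> - a" using r(2) by (rule tendsto_minus)
  then have "(\<lambda>l. p k ((- c (r l)) \<cdot> b - (- a) \<cdot> b)) \<longlonglongrightarrow> 0" for k
    by (rule tendsto_scaled) simp
  from tendsto_sum_diff[OF wr this]
  have "(\<lambda>l. p k (w (r l) - c (r l) \<cdot> b - (u - a \<cdot> b))) \<longlonglongrightarrow> 0" for k by simp
  from cl_limit[OF c this] have "u - a \<cdot> b \<in> Z" using Z(2) by blast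
  then show ?thesis by blast
qed

end

lemma (in vector_space) span_sequence_bounded:
  assumes "u \<in> span (x ` {n::nat..})"
  shows "\<exists>m. u \<in> span (x ` {n..<m})"
  using assms
proof (induction rule: span_induct_alt)
  case base
  then show ?case by (simp add: span_zero)
next
  case (step c y z)
  then obtain j m where *: "n \<le> j" "y = x j" "z \<in> span (x ` {n..<m})" by auto
  let ?m = "max m (Suc j)"
  have z: "z \<in> span (x ` {n..<?m})"
    using *(3) span_mono[of "x ` {n..<m}" "x ` {n..<?m}"] by fastforce
  have y: "y \<in> span (x ` {n..<?m})" using * by (intro span_base) auto
  have "scale c y + z \<in> span (x ` {n..<?m})" by (intro span_add span_scale y z)
  then show ?case by (rule exI)
qed

text \<open>A dimension count modulo \<open>Z\<close>, done with representatives: the chosen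
  \<open>f s\<close> either collide, and a difference of two elements of \<open>S\<close> lies in
  \<open>Z\<close>, or they are linearly dependent, and the same relation between the elements of
  \<open>S\<close> lies in \<open>Z\<close>.\<close>

lemma (in vector_space) span_meets_complement:
  assumes S: "independent S" "finite S" and Z: "subspace Z" and F: "finite F" "card F < card S"
    and dec: "\<And>s. s \<in> S \<Longrightarrow> \<exists>f\<in>span F. s - f \<in> Z"
  shows "\<exists>y\<in>span S. y \<in> Z \<and> y \<noteq> 0"
proof -
  from dec obtain f where f: "\<And>s. s \<in> S \<Longrightarrow> f s \<in> span F" "\<And>s. s \<in> S \<Longrightarrow> s - f s \<in> Z" by metis
  show ?thesis
  proof (cases "inj_on f S")
    case False
    then obtain s t where st: "s \<in> S" "t \<in> S" "f s = f t" "s \<noteq> t" unfolding inj_on_def by blast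
    have "(s - f s) - (t - f t) \<in> Z" by (intro subspace_diff[OF Z] f(2) st)
    then have "s - t \<in> Z" using st by simp
    then show ?thesis using st by (intro bexI[of _ "s - t"]) (auto intro: span_diff span_base)
  next
    case True
    have "dependent (f ` S)"
    proof (rule ccontr)
      assume "independent (f ` S)"
      from independent_span_bound[OF F(1) this] f(1) have "card (f ` S) \<le> card F" by blast
      with F(2) card_image[OF True] show False by simp
    qed
    then obtain u where u: "\<exists>v\<in>f ` S. u v \<noteq> 0" "(\<Sum>v\<in>f ` S. scale (u v) v) = 0"
      using dependent_finite[of "f ` S"] S(2) by auto
    let ?y = "\<Sum>s\<in>S. scale (u (f s)) s"
    have "(\<Sum>s\<in>S. scale (u (f s)) (f s)) = 0" using u(2) by (simp add: sum.reindex[OF True])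
    then have "?y = (\<Sum>s\<in>S. scale (u (f s)) (s - f s))"
      by (simp add: scale_right_diff_distrib sum_subtractf)
    then have "?y \<in> Z" using Z f(2) by (auto intro: subspace_sum subspace_scale)
    moreover have "?y \<noteq> 0"
    proof
      assume "?y = 0"
      then have "u (f s) = 0" if "s \<in> S" for s
        using independentD[OF S(1,2) subset_refl, of "\<lambda>s. u (f s)"] that by blast
      with u(1) show False by blast
    qed
    moreover have "?y \<in> span S" by (intro span_sum span_scale span_base)
    ultimately show ?thesis by blast
  qed
qed

section \<open>A subspace that contains no copy of the whole space\<close>

text \<open>Non-equivalence of consecutive norms in a form stable under \<open>p k\<close>-small
  changes: \<open>p (Suc k)\<close> is large on a whole \<open>p k\<close>-ball, not just at its
  centre.\<close>

locale spread_norms = graded_norms sc p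
  for sc :: "'k::real_or_complex \<Rightarrow> 'e::ab_group_add \<Rightarrow> 'e" (infixr \<open>\<cdot>\<close> 75)
    and p :: "nat \<Rightarrow> 'e \<Rightarrow> real" +
  assumes spread: "d > 0 \<Longrightarrow> \<exists>y. p k y < d \<and> (\<exists>e>0. \<forall>w. p k (w - y) < e \<longrightarrow> H < p (Suc k) w)"
begin

lemma spread_sequence:
  obtains y where "(\<lambda>l. p k (y l)) \<longlonglongrightarrow> 0"
    "\<And>l. \<exists>e>0. \<forall>w. p k (w - y l) < e \<longrightarrow> real l < p (Suc k) w"
proof -
  have "\<forall>l. \<exists>y. p k y < inverse (real (Suc l)) \<and> (\<exists>e>0. \<forall>w. p k (w - y) < e \<longrightarrow> real l < p (Suc k) w)"
    by (intro allI spread) simp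
  then obtain y where y: "\<And>l. p k (y l) < inverse (real (Suc l))"
    "\<And>l. \<exists>e>0. \<forall>w. p k (w - y l) < e \<longrightarrow> real l < p (Suc k) w" by metis
  have "(\<lambda>l. p k (y l)) \<longlonglongrightarrow> 0"
    by (intro tendsto_sandwich[OF _ _ tendsto_const LIMSEQ_inverse_real_of_nat] always_eventually allI)
       (auto intro: less_imp_le y(1) simp del: of_nat_Suc)
  with y(2) show ?thesis using that by blast
qed

abbreviation dominated :: "nat \<Rightarrow> real \<Rightarrow> 'e set" where
  "dominated i \<eta> \<equiv> dominated_interior i (p (Suc i)) \<eta>"

lemma seminorm_p: "seminorm sc (p k)"
  by unfold_locales

text \<open>The estimates are secured for increasing \<open>i\<close>. At stage \<open>J\<close> the
  vector is changed by some \<open>y l\<close> small in \<open>p J\<close>: the estimates for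
  \<open>i < J\<close> survive because they are open and \<open>p i \<le> p J\<close>, the one for
  \<open>J\<close> is gained because \<open>p (Suc J)\<close> is large near \<open>y l\<close>, and
  higher ones are not yet demanded.\<close>

lemma exists_next:
  assumes "\<And>n. \<eta> n > 0" "\<And>n. finite (B n)"
    and "\<And>i n x. i \<le> n \<Longrightarrow> n \<le> m \<Longrightarrow> x \<in> span (B n) \<Longrightarrow> x \<noteq> 0 \<Longrightarrow> x \<in> dominated i (\<eta> n)"
  shows "\<exists>v. \<forall>n\<le>m. \<forall>i\<le>n. \<forall>x\<in>span (B n). \<forall>a. x \<noteq> 0 \<or> a \<noteq> 0 \<longrightarrow> x + a \<cdot> v \<in> dominated i (\<eta> n)"
proof -
  have "\<exists>v. \<forall>n\<in>{..m}. \<forall>i\<in>{..n}. i < J \<longrightarrow>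
      (\<forall>x\<in>span (B n). \<forall>a. x \<noteq> 0 \<or> a \<noteq> 0 \<longrightarrow> x + a \<cdot> v \<in> dominated i (\<eta> n))" for J
  proof (induction J)
    case (Suc J)
    from Suc.IH obtain v where "\<forall>n\<in>{..m}. \<forall>i\<in>{..n}. i < J \<longrightarrow>
      (\<forall>x\<in>span (B n). \<forall>a. x \<noteq> 0 \<or> a \<noteq> 0 \<longrightarrow> x + a \<cdot> v \<in> dominated i (\<eta> n))" ..
    then have v: "x + a \<cdot> v \<in> dominated i (\<eta> n)"
      if "n \<le> m" "i \<le> n" "i < J" "x \<in> span (B n)" "x \<noteq> 0 \<or> a \<noteq> 0" for n i x a
      using that by auto
    obtain y where y: "(\<lambda>l. p J (y l)) \<longlonglongrightarrow> 0"
      "\<And>l. \<exists>e>0. \<forall>w. p J (w - y l) < e \<longrightarrow> real l < p (Suc J) w" using spread_sequence by blast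
    have "\<forall>\<^sub>F l in sequentially. \<forall>n\<in>{..m}. \<forall>i\<in>{..n}. i < Suc J \<longrightarrow>
      (\<forall>x\<in>span (B n). \<forall>a. x \<noteq> 0 \<or> a \<noteq> 0 \<longrightarrow> x + a \<cdot> (v + y l) \<in> dominated i (\<eta> n))"
    proof (intro eventually_ball_finite finite_atMost ballI)
      fix n i assume ni: "n \<in> {..m}" "i \<in> {..n}"
      consider "i < J" | "i = J" | "J < i" by linarith
      then show "\<forall>\<^sub>F l in sequentially. i < Suc J \<longrightarrow>
        (\<forall>x\<in>span (B n). \<forall>a. x \<noteq> 0 \<or> a \<noteq> 0 \<longrightarrow> x + a \<cdot> (v + y l) \<in> dominated i (\<eta> n))"
      proof cases
        case 1
        have "(\<lambda>l. p i (y l)) \<longlonglongrightarrow> 0"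
          by (intro tendsto_sandwich[OF _ _ tendsto_const y(1)] always_eventually allI mono)
             (use 1 in simp_all)
        from eventually_perturbed[OF assms(2) p_open_dominated_interior cone_dominated_interior[OF seminorm_p] v this]
        show ?thesis using 1 ni by simp
      next
        case 2
        have "\<forall>\<^sub>F l in sequentially.
          (\<forall>x\<in>span (B n). \<forall>a. x \<noteq> 0 \<or> a \<noteq> 0 \<longrightarrow> x + a \<cdot> (v + y l) \<in> dominated J (\<eta> n))"
          by (rule eventually_extends[OF assms(2) seminorm_p assms(1) assms(3) y]) (use 2 ni in auto)
        then show ?thesis using 2 by simp
      qed simp
    qed
    from eventually_happens'[OF sequentially_bot this] show ?case by (rule exE) (rule exI)
  qed simp
  from this[of "Suc m"] show ?thesis by (rule ex_forward) (auto simp: less_Suc_eq_le)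
qed

text \<open>Each new vector is chosen for all the earlier spans together, so the estimate for a
  combination follows by splitting off the last vector.\<close>

lemma exists_dominated_sequence:
  assumes "\<And>n. \<eta> n > 0"
  shows "\<exists>x. \<forall>i n m. i \<le> n \<longrightarrow> (\<forall>u\<in>span (x ` {n..<m}). u \<noteq> 0 \<longrightarrow> u \<in> dominated i (\<eta> n)) \<and>
    (n \<le> m \<longrightarrow> x m \<notin> span (x ` {n..<m}))"
proof -
  \<comment> \<open>One vector serves all the tails \<open>n \<le> m\<close>, each with its own
    \<open>\<eta> n\<close>. For \<open>n = m\<close> the span is zero and the condition concerns
    the nonzero multiples of \<open>v\<close> alone.\<close>
  define P where "P f m v \<longleftrightarrow> (\<forall>n\<le>m. \<forall>i\<le>n. \<forall>x\<in>span (f ` {n..<m}). \<forall>a. x \<noteq> 0 \<or> a \<noteq> 0 \<longrightarrow>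
    x + a \<cdot> v \<in> dominated i (\<eta> n))" for f and m :: nat and v
  have inv: "u \<in> dominated i (\<eta> n)"
    if f: "\<And>j. j < m \<Longrightarrow> P f j (f j)" and *: "i \<le> n" "u \<in> span (f ` {n..<m})" "u \<noteq> 0" for f m i n u
    using f *(2,3)
  proof (induction m arbitrary: u)
    case (Suc m)
    show ?case
    proof (cases "n \<le> m")
      case True
      then have "f ` {n..<Suc m} = insert (f m) (f ` {n..<m})" by (simp add: atLeastLessThanSuc)
      with Suc.prems(2) obtain a where a: "u - a \<cdot> f m \<in> span (f ` {n..<m})"
        by (auto simp: span_breakdown_eq)
      have "u - a \<cdot> f m \<noteq> 0 \<or> a \<noteq> 0" using Suc.prems(3) by auto
      with Suc.prems(1)[of m] a True *(1) have "(u - a \<cdot> f m) + a \<cdot> f m \<in> dominated i (\<eta> n)"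
        unfolding P_def by blast
      then show ?thesis by simp
    qed (use Suc.prems in simp)
  qed simp
  have "\<exists>f. \<forall>m. P f m (f m)"
  proof (rule dependent_wellorder_choice)
    fix f g :: "nat \<Rightarrow> 'e" and m v assume "\<And>j. j < m \<Longrightarrow> f j = g j"
    then have "f ` {n..<m} = g ` {n..<m}" for n by (intro image_cong) auto
    then show "P f m v = P g m v" unfolding P_def by simp
  next
    fix f :: "nat \<Rightarrow> 'e" and m assume "\<And>j. j < m \<Longrightarrow> P f j (f j)"
    from inv[OF this] show "\<exists>v. P f m v"
      unfolding P_def by (intro exists_next[of \<eta> "\<lambda>n. f ` {n..<m}"] assms) auto
  qed
  then obtain x where x: "\<And>m. P x m (x m)" by blast
  have "x m \<notin> span (x ` {n..<m})" if "n \<le> m" for n m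
  proof
    assume *: "x m \<in> span (x ` {n..<m})"
    \<comment> \<open>A dependent \<open>x m\<close> would put 0 into the dominated set, which the
      strict inequality forbids.\<close>
    have "- x m + 1 \<cdot> x m \<in> dominated n (\<eta> n)"
      using x[of m] that span_neg[OF *] unfolding P_def by (metis order_refl zero_neq_one)
    from dominated_interior_less[OF this] show False by simp
  qed
  then show ?thesis using inv[of _ x] x by blast
qed

text \<open>The conditions on \<open>\<phi>\<close> are what a linear homeomorphism into
  \<open>M\<close> yields: continuity in every norm, and for its inverse a bound in the lowest norm,
  which suffices because the constants \<open>D n\<close> compare with \<open>p 0\<close>.\<close>

lemma exists_unembeddable_subspace:
  assumes "infinite_dimensional sc UNIV"
  shows "\<exists>M. subspace M \<and> cl M = M \<and> infinite_dimensional sc M \<and>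
    (\<forall>\<phi> k C. Vector_Spaces.linear sc sc \<phi> \<longrightarrow> range \<phi> \<subseteq> M \<longrightarrow>
      (\<forall>x. p 0 x \<le> C * p k (\<phi> x)) \<longrightarrow> (\<forall>q. \<exists>r D. \<forall>x. p q (\<phi> x) \<le> D * p r x) \<longrightarrow> False)"
proof -
  obtain W where W: "independent W" "span W = UNIV"
    using maximal_independent_subset_extend[of "{}" UNIV] independent_empty by (metis empty_subsetI span_superset top.extremum_uniqueI span_UNIV span_mono subset_antisym span_span)
  have "infinite W" using assms W(2) unfolding infinite_dimensional_def by blast
  from infinite_countable_subset[OF this] obtain w :: "nat \<Rightarrow> 'e" where
    w: "inj w" "range w \<subseteq> W" by blast
  have indep: "independent (w ` {..n})" for n
    by (rule independent_mono[OF W(1)]) (use w(2) in auto)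
  have "\<forall>n. \<exists>D\<ge>1. \<forall>x\<in>span (w ` {..n}). p n x \<le> D * p 0 x"
    using finite_span_dominates[OF _ seminorm_p] by blast
  then obtain D where D: "\<And>n. D n \<ge> 1" "\<And>n x. x \<in> span (w ` {..n}) \<Longrightarrow> p n x \<le> D n * p 0 x" by metis
  define \<eta> where "\<eta> n = 1 / (real (Suc n) * D n)" for n
  have \<eta>: "\<eta> n > 0" for n using D(1)[of n] by (simp add: \<eta>_def)
  from exists_dominated_sequence[of \<eta>, OF \<eta>] obtain x where
    x: "\<And>i n m u. i \<le> n \<Longrightarrow> u \<in> span (x ` {n..<m}) \<Longrightarrow> u \<noteq> 0 \<Longrightarrow> u \<in> dominated i (\<eta> n)"
    "\<And>n m. n \<le> m \<Longrightarrow> x m \<notin> span (x ` {n..<m})" by blast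
  define Z where "Z n = cl (span (x ` {n..}))" for n
  have Zsub: "subspace (Z n)" for n unfolding Z_def by (intro subspace_cl subspace_span)
  have Zcl: "cl (Z n) = Z n" for n unfolding Z_def by (rule cl_cl)
  \<comment> \<open>Passing from the span to its closure costs only the strictness of the
    inequality.\<close>
  have Zest: "p i z \<le> \<eta> n * p (Suc i) z" if z: "z \<in> Z n" and i: "i \<le> n" for z i n
  proof -
    from z obtain s where s: "\<And>l::nat. s l \<in> span (x ` {n..})" "\<And>k. (\<lambda>l. p k (s l - z)) \<longlonglongrightarrow> 0"
      unfolding Z_def by (metis cl_sequence)
    have "p i (s l) \<le> \<eta> n * p (Suc i) (s l)" for l
    proof (cases "s l = 0")
      case False
      obtain m where "s l \<in> span (x ` {n..<m})" using span_sequence_bounded[OF s(1)] by blast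
      from dominated_interior_less[OF x(1)[OF i this False]] show ?thesis by simp
    qed simp
    moreover have "(\<lambda>l. p i (s l)) \<longlonglongrightarrow> p i z" "(\<lambda>l. \<eta> n * p (Suc i) (s l)) \<longlonglongrightarrow> \<eta> n * p (Suc i) z"
      by (intro tendsto_mult_left tendsto_seminorm s)+
    ultimately show ?thesis by (intro LIMSEQ_le) auto
  qed
  have Zstep: "Z n \<subseteq> cl (span (insert (x n) (Z (Suc n))))" for n
  proof -
    have "x ` {n..} = insert (x n) (x ` {Suc n..})"
      unfolding image_insert[symmetric] by (rule image_cong) auto
    moreover have "x ` {Suc n..} \<subseteq> Z (Suc n)"
      unfolding Z_def by (rule order.trans[OF span_superset cl_increasing])
    ultimately show ?thesis unfolding Z_def[of n] by (intro cl_mono span_mono) auto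
  qed
  \<comment> \<open>This is the codimension bound: \<open>n\<close> vectors are peeled off one by
    one, and closedness of \<open>Z (Suc n)\<close> ensures that only a multiple of
    \<open>x n\<close> has to be removed at each stage.\<close>
  have dec: "\<exists>f\<in>span (x ` {..<n}). u - f \<in> Z n" if "u \<in> Z 0" for u n
  proof (induction n)
    case 0
    show ?case using that by simp
  next
    case (Suc n)
    then obtain f where f: "f \<in> span (x ` {..<n})" "u - f \<in> Z n" by blast
    obtain c where c: "u - f - c \<cdot> x n \<in> Z (Suc n)"
      using cl_span_insert[OF Zsub eq_refl[OF Zcl], of "u - f" "x n" "Suc n"] Zstep f(2) by blast
    have "span (x ` {..<n}) \<subseteq> span (x ` {..<Suc n})" by (intro span_mono image_mono) auto
    then have "f + c \<cdot> x n \<in> span (x ` {..<Suc n})"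
      using f(1)
      by (intro span_add span_scale) (auto intro: span_base)
    with c show ?case by (intro bexI[of _ "f + c \<cdot> x n"]) (simp_all add: diff_diff_eq)
  qed
  have infdim: "infinite_dimensional sc (Z 0)"
    unfolding infinite_dimensional_def
  proof
    assume "\<exists>B. finite B \<and> span B = Z 0"
    then obtain B where B: "finite B" "span B = Z 0" by blast
    have ind: "independent (x ` {0..<m}) \<and> card (x ` {0..<m}) = m" for m
    proof (induction m)
      case (Suc m)
      have new: "x m \<notin> span (x ` {0..<m})" by (rule x(2)) simp
      then have "x m \<notin> x ` {0..<m}" using span_base by metis
      then show ?case
        using Suc independent_insertI[OF new] by (simp add: atLeastLessThanSuc)
    qed (simp add: independent_empty)
    have "x ` {0..<m} \<subseteq> span B" for m
      unfolding B(2) Z_def by (rule order.trans[OF _ order.trans[OF span_superset cl_increasing]]) auto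
    from independent_span_bound[OF B(1) conjunct1[OF ind] this, of "Suc (card B)"] ind[of "Suc (card B)"]
    show False by simp
  qed
  have contradiction: False
    if \<phi>: "Vector_Spaces.linear sc sc \<phi>" "range \<phi> \<subseteq> Z 0" "\<And>x. p 0 x \<le> C * p k (\<phi> x)"
      and cont: "\<And>q. \<exists>r D. \<forall>x. p q (\<phi> x) \<le> D * p r x" for \<phi> k C
  proof -
    interpret \<phi>: Vector_Spaces.linear sc sc \<phi> by fact
    from cont[of "Suc k"] obtain r C' where C': "\<And>x. p (Suc k) (\<phi> x) \<le> C' * p r x" by blast
    have inj: "inj \<phi>"
      unfolding \<phi>.inj_iff_eq_0
    proof (intro allI impI)
      fix x assume "\<phi> x = 0"
      with \<phi>(3)[of x] have "p 0 x \<le> 0" by simp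
      then show "x = 0" using nonneg[of 0 x] eq_zero_iff[of 0 x] by simp
    qed
    define K where "K = max 1 C' * max 1 C"
    obtain N :: nat where N: "K < real N" using reals_Archimedean2 by blast
    \<comment> \<open>Large enough for three purposes: \<open>k \<le> n\<close> makes the tail
      estimate apply to \<open>p k\<close>, \<open>r \<le> n\<close> gives
      \<open>p r \<le> p n\<close>, and \<open>n \<ge> N\<close> makes the final factor
      \<open>K / (n + 1)\<close> less than 1.\<close>
    define n where "n = max N (max k r)"
    have n: "k \<le> n" "r \<le> n" "K < real (Suc n)" using N by (auto simp: n_def)
    have "\<exists>y\<in>span (\<phi> ` w ` {..n}). y \<in> Z n \<and> y \<noteq> 0"
    proof (rule span_meets_complement[of "\<phi> ` w ` {..n}" "Z n" "x ` {..<n}"])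
      show "independent (\<phi> ` w ` {..n})"
        using \<phi>.independent_injective_image[OF indep inj_on_subset[OF inj subset_UNIV]] .
      have "card (\<phi> ` w ` {..n}) = Suc n"
        using card_image[OF inj_on_subset[OF inj subset_UNIV]] card_image[OF inj_on_subset[OF w(1) subset_UNIV]] by simp
      then show "card (x ` {..<n}) < card (\<phi> ` w ` {..n})"
        using card_image_le[of "{..<n}" x] by simp
      show "\<exists>f\<in>span (x ` {..<n}). s - f \<in> Z n" if "s \<in> \<phi> ` w ` {..n}" for s
        using dec[of s n] that \<phi>(2) by fast
    qed (simp_all add: Zsub)
    then obtain v where v: "v \<in> span (w ` {..n})" "\<phi> v \<in> Z n" "\<phi> v \<noteq> 0"
      using \<phi>.span_image[of "w ` {..n}"] by auto
    let ?y = "\<phi> v"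
    have "p (Suc k) ?y \<le> C' * p r v" by (rule C')
    also have "\<dots> \<le> max 1 C' * p n v" by (intro mult_mono mono n) auto
    also have "\<dots> \<le> max 1 C' * (D n * p 0 v)" using D(2)[OF v(1)] by (intro mult_left_mono) auto
    also have "\<dots> \<le> max 1 C' * (D n * (max 1 C * p k ?y))"
    proof (intro mult_left_mono)
      have "p 0 v \<le> C * p k ?y" by (rule \<phi>(3))
      also have "\<dots> \<le> max 1 C * p k ?y" by (intro mult_right_mono) auto
      finally show "p 0 v \<le> max 1 C * p k ?y" .
    qed (use D(1)[of n] in auto)
    also have "\<dots> \<le> max 1 C' * (D n * (max 1 C * (\<eta> n * p (Suc k) ?y)))"
      using D(1)[of n] by (intro mult_left_mono Zest[OF v(2) n(1)]) auto
    also have "\<dots> = K / real (Suc n) * p (Suc k) ?y"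
      using D(1)[of n] by (simp add: \<eta>_def K_def field_simps del: of_nat_Suc)
    also have "\<dots> < 1 * p (Suc k) ?y"
      using n(3) v(3) by (intro mult_strict_right_mono) (simp_all add: field_simps del: of_nat_Suc)
    finally show False by simp
  qed
  show ?thesis
  proof (intro exI[of _ "Z 0"] conjI allI impI)
    fix \<phi> k C
    assume "Vector_Spaces.linear sc sc \<phi>" "range \<phi> \<subseteq> Z 0" "\<forall>x. p 0 x \<le> C * p k (\<phi> x)"
      "\<forall>q. \<exists>r D. \<forall>x. p q (\<phi> x) \<le> D * p r x"
    then show False by (intro contradiction[of \<phi> C k]) simp_all
  qed (fact Zsub Zcl infdim)+
qed

end

section \<open>Seminorms of Frechet spaces\<close>

context topological_vector_space
begin

lemma continuous_on_scale:
  assumes "continuous_on S f" "continuous_on S g"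
  shows "continuous_on S (\<lambda>x. sc (f x) (g x))"
  using continuous_on_compose2[OF continuous_scale continuous_on_Pair[OF assms]] by simp

lemma seminorm_continuous:
  assumes "seminorm sc q" "open U" "0 \<in> U" "\<And>x. x \<in> U \<Longrightarrow> q x \<le> C"
  shows "continuous_on UNIV q"
proof -
  interpret q: seminorm sc q by fact
  have "(q \<longlongrightarrow> q x) (at x)" for x
  proof (rule tendstoI)
    fix e :: real assume e: "e > 0"
    define c :: 'k where "c = of_real ((\<bar>C\<bar> + 1) / e)"
    have nc: "norm c = (\<bar>C\<bar> + 1) / e" using e unfolding c_def norm_of_real by simp
    let ?V = "(\<lambda>y. sc c (y - x)) -` U"
    have "open ?V"
      by (intro open_vimage assms(2) continuous_on_scale continuous_intros)
    moreover have "x \<in> ?V" using assms(3) by simp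
    moreover have "dist (q y) (q x) < e" if "y \<in> ?V" for y
    proof -
      have "(\<bar>C\<bar> + 1) / e * q (y - x) \<le> C"
        using assms(4)[of "sc c (y - x)"] that by (simp add: q.homogeneous nc)
      then have "(\<bar>C\<bar> + 1) * q (y - x) \<le> C * e" using e by (simp add: field_simps)
      also have "\<dots> < (\<bar>C\<bar> + 1) * e" using e by (intro mult_strict_right_mono) auto
      finally have "q (y - x) < e" by (simp add: mult_less_cancel_left_pos add_nonneg_pos)
      then show ?thesis
        using q.reverse_triangle[of y x] q.reverse_triangle[of x y] q.commute[of x y]
        unfolding dist_real_def by linarith
    qed
    ultimately show "\<forall>\<^sub>F y in at x. dist (q y) (q x) < e"
      unfolding eventually_at_topological by blast
  qed
  then show ?thesis by (simp add: continuous_on_def)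
qed

text \<open>The Minkowski functional of the balanced core of \<open>V\<close>.\<close>

lemma exists_seminorm_below:
  assumes V: "convex_set sc V" "open V" "0 \<in> V"
  shows "\<exists>q. seminorm sc q \<and> continuous_on UNIV q \<and> {x. q x < 1} \<subseteq> V"
proof -
  define W where "W = {x. \<forall>c. norm c \<le> 1 \<longrightarrow> sc c x \<in> V}"
  have WV: "W \<subseteq> V" unfolding W_def using scale_one by (metis (no_types, lifting) mem_Collect_eq norm_one order_refl subsetI)
  have W0: "0 \<in> W" using V(3) by (simp add: W_def)
  have balanced: "sc c x \<in> W" if "x \<in> W" "norm c \<le> 1" for c x
    unfolding W_def
  proof (intro CollectI allI impI)
    fix b :: 'k assume "norm b \<le> 1"
    then have "norm (b * c) \<le> 1" using that(2) by (simp add: norm_mult mult_le_one)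
    then show "sc b (sc c x) \<in> V" using that(1) by (simp add: W_def)
  qed
  have convex: "sc (of_real (1 - t)) x + sc (of_real t) y \<in> W"
    if xy: "x \<in> W" "y \<in> W" "0 \<le> t" "t \<le> 1" for x y t
    unfolding W_def
  proof (intro CollectI allI impI)
    fix b :: 'k assume "norm b \<le> 1"
    then have "sc b x \<in> V" "sc b y \<in> V" using xy by (simp_all add: W_def)
    then have "sc (of_real (1 - t)) (sc b x) + sc (of_real t) (sc b y) \<in> V"
      using V(1)[unfolded convex_set_def, rule_format, of "sc b x" "sc b y" t] xy by simp
    then show "sc b (sc (of_real (1 - t)) x + sc (of_real t) y) \<in> V"
      by (simp add: scale_right_distrib mult.commute)
  qed
  \<comment> \<open>Joint continuity of scaling at \<open>(0, 0)\<close> gives a ball of scalars and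
    a neighbourhood \<open>B\<close> mapped into \<open>V\<close>; shrinking \<open>B\<close> by the
    factor \<open>d\<close> makes room for all scalars of norm at most 1.\<close>
  obtain U where U: "open U" "0 \<in> U" "U \<subseteq> W"
  proof -
    have "open ((\<lambda>(c, x). sc c x) -` V)" by (intro open_vimage V continuous_scale)
    moreover have "(0, 0) \<in> (\<lambda>(c, x). sc c x) -` V" using V(3) by simp
    ultimately obtain A B where AB: "open A" "open B" "(0, 0) \<in> A \<times> B" "A \<times> B \<subseteq> (\<lambda>(c, x). sc c x) -` V"
      by (rule open_prod_elim)
    from AB(1,3) obtain e where e: "e > 0" "ball 0 e \<subseteq> A" by (auto elim: openE)
    define d :: 'k where "d = of_real (e / 2)"
    have d: "norm d = e / 2" "d \<noteq> 0" using e(1) unfolding d_def norm_of_real by simp_all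
    let ?U = "(\<lambda>x. sc (inverse d) x) -` B"
    have "open ?U" by (intro open_vimage AB continuous_on_scale continuous_intros)
    moreover have "0 \<in> ?U" using AB(3) by simp
    moreover have "?U \<subseteq> W"
    proof
      fix x assume x: "x \<in> ?U"
      show "x \<in> W" unfolding W_def
      proof (intro CollectI allI impI)
        fix c :: 'k assume c: "norm c \<le> 1"
        have "norm (c * d) \<le> 1 * (e / 2)" unfolding norm_mult d using c e(1) by (intro mult_right_mono) auto
        then have "norm (c * d) < e" using e(1) by simp
        then have "c * d \<in> A" using e(2) by auto
        then have "(c * d, sc (inverse d) x) \<in> A \<times> B" using x by simp
        from subsetD[OF AB(4) this] have "sc (c * d) (sc (inverse d) x) \<in> V" by simp
        then show "sc c x \<in> V" using d(2) by (simp add: mult.assoc)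
      qed
    qed
    ultimately show ?thesis using that by blast
  qed
  define T where "T x = {t. 0 < t \<and> sc (of_real (inverse t)) x \<in> W}" for x
  define q where "q x = Inf (T x)" for x
  have bdd: "bdd_below (T x)" for x unfolding T_def by (rule bdd_belowI[of _ 0]) auto
  have ne: "T x \<noteq> {}" for x
  proof -
    have "open ((\<lambda>c. sc c x) -` U)" by (intro open_vimage U continuous_on_scale continuous_intros)
    moreover have "0 \<in> (\<lambda>c. sc c x) -` U" using U(2) by simp
    ultimately obtain e where e: "e > 0" "ball 0 e \<subseteq> (\<lambda>c. sc c x) -` U" by (rule openE)
    have "of_real (e / 2) \<in> ball (0::'k) e" using e(1) unfolding mem_ball dist_0_norm norm_of_real by simp
    then have "sc (of_real (e / 2)) x \<in> W" using subsetD[OF e(2)] subsetD[OF U(3)] by simp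
    then have "2 / e \<in> T x" using e(1) by (simp add: T_def)
    then show ?thesis by blast
  qed
  have q_le: "q x \<le> t" if "t \<in> T x" for x t
    unfolding q_def by (rule cInf_lower[OF that bdd])
  have q_approx: "\<exists>t\<in>T x. t < q x + e" if "e > 0" for x e
    using cInf_less_iff[OF ne bdd, of x "q x + e"] that unfolding q_def by simp
  have q_nonneg: "0 \<le> q x" for x
    unfolding q_def by (rule cInf_greatest[OF ne]) (simp add: T_def)
  have q_scale_le: "q (sc c x) \<le> norm c * q x" if c: "c \<noteq> 0" for c x
  proof (rule field_le_epsilon)
    fix e :: real assume "e > 0"
    then have "e / norm c > 0" using c by simp
    from q_approx[OF this] obtain t where t: "t \<in> T x" "t < q x + e / norm c" by blast
    have c1: "norm (c / of_real (norm c)) \<le> 1" using c by (simp add: norm_divide)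
    have "sc (of_real (inverse t)) x \<in> W" using t(1) by (simp only: T_def mem_Collect_eq)
    from balanced[OF this c1] have "sc (c / of_real (norm c)) (sc (of_real (inverse t)) x) \<in> W" .
    then have "sc (of_real (inverse (norm c * t))) (sc c x) \<in> W"
      using c by (simp add: field_simps)
    then have "norm c * t \<in> T (sc c x)" using c t(1) by (simp add: T_def)
    then have "q (sc c x) \<le> norm c * t" by (rule q_le)
    also have "\<dots> \<le> norm c * (q x + e / norm c)" using t(2) by (intro mult_left_mono) auto
    also have "\<dots> = norm c * q x + e" using c by (simp add: distrib_left)
    finally show "q (sc c x) \<le> norm c * q x + e" .
  qed
  have q0: "q 0 = 0"
  proof (rule antisym[OF field_le_epsilon q_nonneg])
    fix e :: real assume "e > 0"
    then have "e \<in> T 0" using W0 by (simp add: T_def)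
    then show "q 0 \<le> 0 + e" using q_le by simp
  qed
  have "seminorm sc q"
  proof
    fix x y c
    show "q (x + y) \<le> q x + q y"
    proof (rule field_le_epsilon)
      fix e :: real assume "e > 0"
      then have e: "e / 2 > 0" by simp
      from q_approx[OF e] obtain s where s: "s \<in> T x" "s < q x + e / 2" by blast
      from q_approx[OF e] obtain t where t: "t \<in> T y" "t < q y + e / 2" by blast
      have pos: "0 < s" "0 < t" using s t by (auto simp: T_def)
      \<comment> \<open>With weights \<open>s / (s + t)\<close> and \<open>t / (s + t)\<close>, the
        points \<open>x / s\<close> and \<open>y / t\<close> of \<open>W\<close> combine to
        \<open>(x + y) / (s + t)\<close>.\<close>
      have 1: "(1 - t / (s + t)) * inverse s = inverse (s + t)" "t / (s + t) * inverse t = inverse (s + t)"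
        using pos by (simp_all add: field_simps)
      have "sc (of_real (1 - t / (s + t))) (sc (of_real (inverse s)) x) +
          sc (of_real (t / (s + t))) (sc (of_real (inverse t)) y) \<in> W"
        using s(1) t(1) pos by (intro convex) (auto simp: T_def)
      then have "sc (of_real (inverse (s + t))) (x + y) \<in> W"
        unfolding scale_scale of_real_mult[symmetric] 1 by (simp only: scale_right_distrib)
      then have "s + t \<in> T (x + y)" using pos by (simp add: T_def)
      from q_le[OF this] show "q (x + y) \<le> q x + q y + e" using s(2) t(2) by linarith
    qed
    show "q (sc c x) = norm c * q x"
    proof (cases "c = 0")
      case False
      have "q x \<le> inverse (norm c) * q (sc c x)"
        using q_scale_le[of "inverse c" "sc c x"] False by (simp add: norm_inverse)
      then show ?thesis using q_scale_le[OF False, of x] False by (simp add: field_simps)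
    qed (simp add: q0)
  qed
  moreover have "continuous_on UNIV q"
  proof (rule seminorm_continuous[OF \<open>seminorm sc q\<close> U(1,2)])
    fix x assume "x \<in> U"
    then have "1 \<in> T x" using U(3) by (auto simp: T_def)
    then show "q x \<le> 1" by (rule q_le)
  qed
  moreover have "{x. q x < 1} \<subseteq> V"
  proof
    fix x assume "x \<in> {x. q x < 1}"
    then obtain t where t: "t \<in> T x" "t < 1"
      using q_approx[of "1 - q x" x] by auto
    then have "sc (of_real (inverse t)) x \<in> W" "norm (of_real t :: 'k) \<le> 1"
      unfolding norm_of_real T_def by simp_all
    then have "sc (of_real t) (sc (of_real (inverse t)) x) \<in> W" by (rule balanced)
    moreover have "of_real t * of_real (inverse t) = (1::'k)"
      using t unfolding of_real_mult[symmetric] by (simp add: T_def)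
    ultimately have "x \<in> W" by simp
    then show "x \<in> V" using WV by blast
  qed
  ultimately show ?thesis by blast
qed

end

locale defining_seminorms = topological_vector_space sc
  for sc :: "'k::real_or_complex \<Rightarrow> 'e::topological_ab_group_add \<Rightarrow> 'e" +
  fixes p :: "nat \<Rightarrow> 'e \<Rightarrow> real"
  assumes seminorms: "seminorm sc (p k)"
    and continuous: "continuous_on UNIV (p k)"
    and increasing: "p k x \<le> p (Suc k) x"
    and neighbourhood: "open U \<Longrightarrow> 0 \<in> U \<Longrightarrow> \<exists>k. \<exists>e>0. {x. p k x < e} \<subseteq> U"
begin

sublocale seminorm sc "p k" for k
  by (rule seminorms)

lemma mono: "i \<le> j \<Longrightarrow> p i x \<le> p j x"
  by (rule lift_Suc_mono_le[of "\<lambda>k. p k x"]) (rule increasing)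

lemma open_ball: "open {y. p k (y - x) < e}"
proof -
  have "continuous_on UNIV (\<lambda>y. p k (y - x))"
    by (rule continuous_on_compose2[OF continuous]) (auto intro!: continuous_intros)
  from open_Collect_less[OF this continuous_on_const] show ?thesis .
qed

lemma tendsto_iff: "(s \<longlongrightarrow> u) F \<longleftrightarrow> (\<forall>k. ((\<lambda>l. p k (s l - u)) \<longlongrightarrow> 0) F)"
proof (intro iffI allI)
  fix k assume s: "(s \<longlongrightarrow> u) F"
  show "((\<lambda>l. p k (s l - u)) \<longlongrightarrow> 0) F"
  proof (rule tendstoI)
    fix e :: real assume "e > 0"
    then have "\<forall>\<^sub>F l in F. s l \<in> {y. p k (y - u) < e}"
      by (intro topological_tendstoD[OF s open_ball]) simp
    then show "\<forall>\<^sub>F l in F. dist (p k (s l - u)) 0 < e" by simp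
  qed
next
  assume s: "\<forall>k. ((\<lambda>l. p k (s l - u)) \<longlongrightarrow> 0) F"
  show "(s \<longlongrightarrow> u) F"
  proof (rule topological_tendstoI)
    fix S assume S: "open S" "u \<in> S"
    have "open ((\<lambda>x. x + u) -` S)" by (intro open_vimage S continuous_intros)
    from neighbourhood[OF this] S(2) obtain k e where ke: "e > 0" "{x. p k x < e} \<subseteq> (\<lambda>x. x + u) -` S"
      by auto
    have "\<forall>\<^sub>F l in F. p k (s l - u) < e" using order_tendstoD(2)[OF s[rule_format] ke(1)] .
    then show "\<forall>\<^sub>F l in F. s l \<in> S" by (rule eventually_mono) (use ke(2) in force)
  qed
qed

end

lemma (in frechet_space) exists_complete_distance:
  obtains d :: "'e \<Rightarrow> 'e \<Rightarrow> real" where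
    "\<And>x y. d x y = d 0 (y - x)" "\<And>e. open {x. d 0 x < e}" "d 0 0 = 0"
    "\<And>U. open U \<Longrightarrow> 0 \<in> U \<Longrightarrow> \<exists>e>0. {x. d 0 x < e} \<subseteq> U"
    "\<And>s. \<forall>e>0. \<exists>N. \<forall>m\<ge>N. \<forall>n\<ge>N. d (s m) (s n) < e \<Longrightarrow> \<exists>u. s \<longlonglongrightarrow> u"
    "\<And>x y. d x y = 0 \<Longrightarrow> x = y" "\<And>x y. 0 \<le> d x y"
proof -
  obtain d :: "'e \<Rightarrow> 'e \<Rightarrow> real" where d: "Metric_space UNIV d" "Metric_space.mtopology UNIV d = euclidean"
    "\<And>x y z. d (x + z) (y + z) = d x y" "Metric_space.mcomplete UNIV d"
    using complete_metrizable by blast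
  interpret M: Metric_space UNIV d by (rule d(1))
  have ball: "M.mball 0 e = {x. d 0 x < e}" for e by (auto simp: M.mball_def)
  show ?thesis
  proof
    show "d x y = d 0 (y - x)" for x y using d(3)[of x "- x" y] by simp
    show "open {x. d 0 x < e}" for e
      using M.openin_mball[of 0 e] unfolding ball d(2) by simp
    show "d 0 0 = 0" by simp
    show "\<exists>e>0. {x. d 0 x < e} \<subseteq> U" if "open U" "0 \<in> U" for U
    proof -
      have "openin M.mtopology U" using that(1) by (simp add: d(2))
      then show ?thesis using that(2) unfolding M.openin_mtopology ball[symmetric] by blast
    qed
    show "\<exists>u. s \<longlonglongrightarrow> u" if "\<forall>e>0. \<exists>N. \<forall>m\<ge>N. \<forall>n\<ge>N. d (s m) (s n) < e" for s
    proof -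
      have "M.MCauchy s" using that unfolding M.MCauchy_def by auto
      then obtain u where "limitin M.mtopology s u sequentially"
        using d(4) unfolding M.mcomplete_def by blast
      then show ?thesis unfolding d(2) limitin_canonical_iff by blast
    qed
  qed simp_all
qed

text \<open>A seminorm is placed below each ball of radius \<open>1 / (k + 1)\<close> of the metric;
  partial sums make the sequence increasing without losing a neighbourhood.\<close>

lemma (in frechet_space) exists_defining_seminorms: "\<exists>p. defining_seminorms sc p"
proof -
  obtain d :: "'e \<Rightarrow> 'e \<Rightarrow> real" where d: "\<And>e. open {x. d 0 x < e}" "d 0 0 = 0"
    "\<And>U. open U \<Longrightarrow> 0 \<in> U \<Longrightarrow> \<exists>e>0. {x. d 0 x < e} \<subseteq> U"
    by (rule exists_complete_distance, rule that, assumption+)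
  have "\<exists>q. seminorm sc q \<and> continuous_on UNIV q \<and> {x. q x < 1} \<subseteq> {x. d 0 x < inverse (real (Suc k))}" for k
  proof -
    have "0 \<in> {x. d 0 x < inverse (real (Suc k))}" by (simp add: d(2) del: of_nat_Suc)
    from locally_convex[OF d(1) this] obtain V where
      V: "open V" "0 \<in> V" "convex_set sc V" "V \<subseteq> {x. d 0 x < inverse (real (Suc k))}" by blast
    from exists_seminorm_below[OF V(3,1,2)] V(4) show ?thesis by (meson order_trans)
  qed
  then obtain q where q: "\<And>k. seminorm sc (q k)" "\<And>k. continuous_on UNIV (q k)"
    "\<And>k. {x. q k x < 1} \<subseteq> {x. d 0 x < inverse (real (Suc k))}" by metis
  define p where "p k x = (\<Sum>j\<le>k. q j x)" for k :: nat and x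
  have "defining_seminorms sc p"
  proof
    fix k x y c
    show "p k (x + y) \<le> p k x + p k y"
      unfolding p_def sum.distrib[symmetric] by (intro sum_mono seminorm.triangle[OF q(1)])
    show "p k (sc c x) = norm c * p k x"
      unfolding p_def sum_distrib_left by (intro sum.cong seminorm.homogeneous[OF q(1)] refl)
    show "continuous_on UNIV (p k)"
      unfolding p_def[abs_def] by (intro continuous_on_sum q(2))
    show "p k x \<le> p (Suc k) x"
      using seminorm.nonneg[OF q(1)] by (simp add: p_def)
  next
    fix U :: "'e set" assume U: "open U" "0 \<in> U"
    from d(3)[OF this] obtain e where e: "e > 0" "{x. d 0 x < e} \<subseteq> U" by blast
    obtain k where k: "inverse (real (Suc k)) < e" using reals_Archimedean[OF e(1)] by blast
    have "{x. p k x < 1} \<subseteq> U"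
    proof
      fix x assume "x \<in> {x. p k x < 1}"
      moreover have "q k x \<le> p k x"
        unfolding p_def by (rule member_le_sum) (simp_all add: seminorm.nonneg[OF q(1)])
      ultimately have "x \<in> {x. q k x < 1}" by simp
      from subsetD[OF q(3) this] have "x \<in> {x. d 0 x < e}" using k by simp
      with e(2) show "x \<in> U" by blast
    qed
    then show "\<exists>k. \<exists>e>0. {x. p k x < e} \<subseteq> U" using zero_less_one by blast
  qed
  then show ?thesis by blast
qed

locale frechet_seminorms = frechet_space sc + defining_seminorms sc p
  for sc :: "'k::real_or_complex \<Rightarrow> 'e::topological_ab_group_add \<Rightarrow> 'e"
    and p :: "nat \<Rightarrow> 'e \<Rightarrow> real"
begin

text \<open>The type class does not make the topology Hausdorff; separation of points is drawn from
  the metric.\<close>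

lemma separating:
  assumes "\<And>k. p k x = 0"
  shows "x = 0"
proof -
  obtain d :: "'e \<Rightarrow> 'e \<Rightarrow> real" where d: "\<And>e. open {x. d 0 x < e}" "d 0 0 = 0"
    "\<And>x y. d x y = 0 \<Longrightarrow> x = y" "\<And>x y. 0 \<le> d x y"
    by (rule exists_complete_distance, rule that, assumption+)
  have "d 0 x < e" if "e > 0" for e
  proof -
    have "0 \<in> {x. d 0 x < e}" using that d(2) by simp
    from neighbourhood[OF d(1) this] obtain k e' where "e' > 0" "{x. p k x < e'} \<subseteq> {x. d 0 x < e}"
      by blast
    moreover from this have "x \<in> {x. p k x < e'}" using assms[of k] by simp
    ultimately show ?thesis by blast
  qed
  from this[of "d 0 x"] d(4)[of 0 x] d(3)[of 0 x] show ?thesis by fastforce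
qed

lemma limit_unique:
  fixes u v :: 'e
  assumes "s \<longlonglongrightarrow> u" "s \<longlonglongrightarrow> v"
  shows "u = v"
proof -
  have "p k (u - v) = 0" for k
  proof -
    have "(\<lambda>l. p k (s l - u) + p k (s l - v)) \<longlonglongrightarrow> 0"
      using assms tendsto_add_zero unfolding tendsto_iff by blast
    moreover have "p k (u - v) \<le> p k (s l - u) + p k (s l - v)" for l
      using triangle_via[of k u v "s l"] commute[of k u "s l"] by simp
    ultimately have "p k (u - v) \<le> 0"
      by (intro tendsto_lowerbound[OF _ always_eventually trivial_limit_sequentially]) blast+
    then show ?thesis using nonneg[of k "u - v"] by linarith
  qed
  from separating[OF this] show ?thesis by simp
qed

lemma complete:
  assumes "\<And>k e. e > 0 \<Longrightarrow> \<exists>N. \<forall>m\<ge>N. \<forall>n\<ge>N. p k (s m - s n) < e"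
  shows "\<exists>u. s \<longlonglongrightarrow> u"
proof -
  obtain d :: "'e \<Rightarrow> 'e \<Rightarrow> real" where d: "\<And>x y. d x y = d 0 (y - x)" "\<And>e. open {x. d 0 x < e}" "d 0 0 = 0"
    "\<And>s. \<forall>e>0. \<exists>N. \<forall>m\<ge>N. \<forall>n\<ge>N. d (s m) (s n) < e \<Longrightarrow> \<exists>u. s \<longlonglongrightarrow> u"
    by (rule exists_complete_distance, rule that, assumption+)
  show ?thesis
  proof (rule d(4), intro allI impI)
    fix e :: real assume "e > 0"
    then have "0 \<in> {x. d 0 x < e}" using d(3) by simp
    from neighbourhood[OF d(2) this] obtain k e' where k: "e' > 0" "{x. p k x < e'} \<subseteq> {x. d 0 x < e}"
      by blast
    from assms[OF k(1)] obtain N where N: "\<forall>m\<ge>N. \<forall>n\<ge>N. p k (s m - s n) < e'" by blast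
    have "d (s m) (s n) < e" if "N \<le> m" "N \<le> n" for m n
      using k(2) N that unfolding d(1)[of "s m"] by auto
    then show "\<exists>N. \<forall>m\<ge>N. \<forall>n\<ge>N. d (s m) (s n) < e" by blast
  qed
qed

lemma closure_sequence:
  fixes u :: 'e
  assumes "u \<in> closure S"
  obtains s where "\<And>l::nat. s l \<in> S" "s \<longlonglongrightarrow> u"
proof -
  have "\<exists>x\<in>S. p l (x - u) < inverse (real (Suc l))" for l
  proof -
    let ?V = "{y. p l (y - u) < inverse (real (Suc l))}"
    have "u \<in> ?V" by (simp del: of_nat_Suc)
    with assms have "?V \<inter> closure S \<noteq> {}" by (metis IntI empty_iff)
    then have "?V \<inter> S \<noteq> {}" unfolding open_Int_closure_eq_empty[OF open_ball] .
    then show ?thesis by blast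
  qed
  then obtain s where s: "\<And>l. s l \<in> S" "\<And>l. p l (s l - u) < inverse (real (Suc l))" by metis
  have "(\<lambda>l. p k (s l - u)) \<longlonglongrightarrow> 0" for k
  proof (rule tendsto_sandwich[OF _ _ tendsto_const LIMSEQ_inverse_real_of_nat])
    show "\<forall>\<^sub>F l in sequentially. p k (s l - u) \<le> inverse (real (Suc l))"
      using eventually_ge_at_top[of k]
    proof eventually_elim
      case (elim l)
      show ?case using mono[OF elim, of "s l - u"] s(2)[of l] by linarith
    qed
  qed simp
  then have "s \<longlonglongrightarrow> u" unfolding tendsto_iff by blast
  with s(1) show ?thesis by (rule that)
qed

end

section \<open>Isomorphisms between subspaces\<close>

lemma homeomorphism_properties:
  assumes "homeomorphism M N f g"
  shows "continuous_on M f" "continuous_on N g" "f ` M = N" "g ` N = M"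
    "\<And>x. x \<in> M \<Longrightarrow> g (f x) = x" "\<And>y. y \<in> N \<Longrightarrow> f (g y) = y"
  using assms unfolding homeomorphism_def by auto

lemma isomorphism_sym:
  assumes "isomorphism_between s1 M s2 N f" "module.subspace s1 M" "vector_space s1"
  obtains g where "isomorphism_between s2 N s1 M g" "homeomorphism M N f g"
proof -
  interpret vector_space s1 by fact
  from assms(1) obtain g where g: "homeomorphism M N f g" unfolding isomorphism_between_def by blast
  note h = homeomorphism_properties[OF g]
  have "g (x + y) = g x + g y" if "x \<in> N" "y \<in> N" for x y
  proof -
    have "g x \<in> M" "g y \<in> M" using h(4) that by blast+
    moreover from this have "f (g x + g y) = x + y"
      using assms(1) that h(6) unfolding isomorphism_between_def by simp
    ultimately show ?thesis using h(5)[of "g x + g y"] subspace_add[OF assms(2)] by simp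
  qed
  moreover have "g (s2 c x) = s1 c (g x)" if "x \<in> N" for c x
  proof -
    have "g x \<in> M" using h(4) that by blast
    moreover from this have "f (s1 c (g x)) = s2 c x"
      using assms(1) that h(6) unfolding isomorphism_between_def by simp
    ultimately show ?thesis using h(5)[of "s1 c (g x)"] subspace_scale[OF assms(2)] by simp
  qed
  ultimately have "isomorphism_between s2 N s1 M g"
    unfolding isomorphism_between_def using homeomorphism_symD[OF g] by blast
  with g show ?thesis by (rule that[rotated])
qed

lemma isomorphism_trans:
  assumes "isomorphism_between s1 M s2 N f" "isomorphism_between s2 N s3 L g"
  shows "isomorphism_between s1 M s3 L (g \<circ> f)"
proof -
  from assms obtain f' g' where h: "homeomorphism M N f f'" "homeomorphism N L g g'"
    unfolding isomorphism_between_def by blast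
  have "f x \<in> N" if "x \<in> M" for x using homeomorphism_properties(3)[OF h(1)] that by blast
  then show ?thesis using assms homeomorphism_compose[OF h] unfolding isomorphism_between_def by auto
qed

lemma isomorphism_restrict:
  assumes "isomorphism_between s1 M s2 N f" "L \<subseteq> M"
  shows "isomorphism_between s1 L s2 (f ` L) f"
proof -
  from assms obtain g where g: "homeomorphism M N f g" unfolding isomorphism_between_def by blast
  have "homeomorphism L (f ` L) f g"
    using homeomorphism_of_subsets[OF g assms(2) _ refl] homeomorphism_properties(3)[OF g] assms(2) by blast
  then show ?thesis using assms unfolding isomorphism_between_def by (meson subsetD)
qed

lemma isomorphism_subspace:
  assumes "isomorphism_between s1 M s2 N f" "module.subspace s1 M" "vector_space s1" "vector_space s2"
  shows "module.subspace s2 N"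
proof -
  interpret s1: vector_space s1 by fact
  interpret s2: vector_space s2 by fact
  have img: "N = f ` M" using assms(1) homeomorphism_properties(3) unfolding isomorphism_between_def by blast
  have add: "\<And>x y. x \<in> M \<Longrightarrow> y \<in> M \<Longrightarrow> f (x + y) = f x + f y"
    and scale: "\<And>c x. x \<in> M \<Longrightarrow> f (s1 c x) = s2 c (f x)"
    using assms(1) unfolding isomorphism_between_def by blast+
  show ?thesis
  proof (rule s2.subspaceI)
    show "0 \<in> N" using scale[OF s1.subspace_0[OF assms(2)], of 0] s1.subspace_0[OF assms(2)] unfolding img
      by (metis image_eqI s1.scale_zero_left s2.scale_zero_left)
  next
    fix x y assume "x \<in> N" "y \<in> N"
    then obtain a b where "a \<in> M" "b \<in> M" "x = f a" "y = f b" unfolding img by blast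
    then show "x + y \<in> N" unfolding img using add[of a b] s1.subspace_add[OF assms(2), of a b]
      by (metis image_eqI)
  next
    fix c x assume "x \<in> N"
    then obtain a where "a \<in> M" "x = f a" unfolding img by blast
    then show "s2 c x \<in> N" unfolding img using scale[of a c] s1.subspace_scale[OF assms(2), of a c]
      by (metis image_eqI)
  qed
qed

lemma isomorphism_infinite_dimensional:
  assumes iso: "isomorphism_between s1 M s2 N f" and M: "module.subspace s1 M"
    and s: "vector_space s1" "vector_space s2" and inf: "infinite_dimensional s1 M"
  shows "infinite_dimensional s2 N"
  unfolding infinite_dimensional_def
proof
  interpret s1: vector_space s1 by fact
  interpret s2: vector_space s2 by fact
  assume "\<exists>B. finite B \<and> s2.span B = N"
  then obtain B where B: "finite B" "s2.span B = N" by blast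
  from isomorphism_sym[OF iso M s(1)] obtain g where
    g: "isomorphism_between s2 N s1 M g" "homeomorphism M N f g" .
  note h = homeomorphism_properties[OF g(2)]
  have add: "\<And>x y. x \<in> N \<Longrightarrow> y \<in> N \<Longrightarrow> g (x + y) = g x + g y"
    and scale: "\<And>c x. x \<in> N \<Longrightarrow> g (s2 c x) = s1 c (g x)"
    using g(1) unfolding isomorphism_between_def by blast+
  have BN: "B \<subseteq> N" using B(2) s2.span_superset by blast
  \<comment> \<open>The map \<open>g\<close> is linear on \<open>N\<close> only, so the induction
    has to carry membership in \<open>N\<close> along.\<close>
  have "y \<in> N \<and> g y \<in> s1.span (g ` B)" if "y \<in> s2.span B" for y
    using that
  proof (induction rule: s2.span_induct_alt)
    case base
    have "0 \<in> N" unfolding B(2)[symmetric] by (rule s2.span_zero)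
    moreover from scale[OF this, of 0] have "g 0 = 0" by simp
    ultimately show ?case by (simp add: s1.span_zero)
  next
    case (step c x y)
    have x: "x \<in> N" using step(1) BN by blast
    have cx: "s2 c x \<in> N" unfolding B(2)[symmetric] by (intro s2.span_scale s2.span_base step)
    have y: "y \<in> N" "g y \<in> s1.span (g ` B)" using step by auto
    have "s2 c x + y \<in> N" using cx y(1) unfolding B(2)[symmetric] by (rule s2.span_add)
    moreover have "g (s2 c x + y) = s1 c (g x) + g y" using add[OF cx y(1)] scale[OF x] by simp
    moreover have "s1 c (g x) + g y \<in> s1.span (g ` B)"
      by (intro s1.span_add s1.span_scale s1.span_base imageI step(1) y(2))
    ultimately show ?case by simp
  qed
  then have "M \<subseteq> s1.span (g ` B)" unfolding B(2) h(4)[symmetric] by blast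
  moreover have "s1.span (g ` B) \<subseteq> M" using h(4) BN by (intro s1.span_minimal M) blast
  ultimately show False using inf B(1) unfolding infinite_dimensional_def by blast
qed

text \<open>Continuity at 0 sends the part of some \<open>p j\<close>-ball in \<open>M\<close> into
  \<open>q < 1\<close>, and homogeneity turns this into a bound on all of \<open>M\<close>.\<close>

lemma isomorphism_estimate:
  assumes iso: "isomorphism_between s1 M s2 N f" and M: "module.subspace s1 M"
    and p: "defining_seminorms s1 p" and q: "seminorm s2 q" "continuous_on UNIV q"
  shows "\<exists>j C. \<forall>x\<in>M. q (f x) \<le> C * p j x"
proof -
  interpret p: defining_seminorms s1 p by fact
  interpret q: seminorm s2 q by fact
  have scale: "\<And>c x. x \<in> M \<Longrightarrow> f (s1 c x) = s2 c (f x)"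
    using iso unfolding isomorphism_between_def by blast
  have M0: "0 \<in> M" using p.subspace_0[OF M] .
  have f0: "f 0 = 0" using scale[OF M0, of 0] by simp
  have "continuous_on M f" using iso homeomorphism_properties(1) unfolding isomorphism_between_def by blast
  moreover have "open {y. q y < 1}" using open_Collect_less[OF q(2) continuous_on_const] .
  ultimately obtain O' where O': "open O'" "O' \<inter> M = f -` {y. q y < 1} \<inter> M"
    unfolding continuous_on_open_invariant by blast
  have "0 \<in> f -` {y. q y < 1} \<inter> M" using M0 f0 by simp
  then have "0 \<in> O'" unfolding O'(2)[symmetric] by simp
  from p.neighbourhood[OF O'(1) this] obtain j e where je: "e > 0" "{x. p j x < e} \<subseteq> O'" by blast
  have small: "q (f x) < 1" if "x \<in> M" "p j x < e" for x
  proof -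
    have "x \<in> O' \<inter> M" using je(2) that by blast
    then show ?thesis unfolding O'(2) by simp
  qed
  have "q (f x) \<le> 2 / e * p j x" if x: "x \<in> M" for x
  proof (rule field_le_epsilon)
    fix r :: real assume r: "r > 0"
    \<comment> \<open>The term \<open>r * e\<close> keeps the denominator positive when
      \<open>p j x = 0\<close>; then \<open>t * q (f x) < 1\<close> reads
      \<open>q (f x) < 2 / e * p j x + r\<close>.\<close>
    define t where "t = e / (2 * p j x + r * e)"
    have pos: "0 < 2 * p j x + r * e" using r je(1) by (intro add_nonneg_pos) auto
    have t: "t > 0" using pos je(1) by (simp add: t_def)
    define c :: 'a where "c = of_real t"
    have c: "norm c = t" using t unfolding c_def norm_of_real by simp
    have "t * p j x < e"
      using r je(1) pos p.nonneg[of j x] by (simp add: t_def field_simps add_pos_nonneg)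
    then have "q (f (s1 c x)) < 1"
      using p.subspace_scale[OF M x] by (intro small) (simp_all add: p.homogeneous c)
    then have "t * q (f x) < 1" by (simp add: scale[OF x] q.homogeneous c)
    then show "q (f x) \<le> 2 / e * p j x + r" using pos je(1) by (simp add: t_def field_simps)
  qed
  then show ?thesis by (intro exI ballI)
qed

section \<open>Copies of subspaces\<close>

text \<open>A sequence of \<open>L\<close> converging in \<open>F\<close> is Cauchy, and the
  estimates for the inverse make its preimage Cauchy in \<open>E\<close>. That preimage converges
  within \<open>N\<close>, and applying \<open>f\<close> returns the limit to
  \<open>L\<close>.\<close>

lemma isomorphic_image_closed:
  assumes E: "frechet_space sE" and F: "frechet_space sF"
    and N: "module.subspace sE N" "closed N" and iso: "isomorphism_between sE N sF L f"
  shows "closed L"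
proof -
  obtain pE where "defining_seminorms sE pE" using frechet_space.exists_defining_seminorms[OF E] by blast
  then interpret E: frechet_seminorms sE pE using E by (intro frechet_seminorms.intro)
  obtain pF where "defining_seminorms sF pF" using frechet_space.exists_defining_seminorms[OF F] by blast
  then interpret F: frechet_seminorms sF pF using F by (intro frechet_seminorms.intro)
  from isomorphism_sym[OF iso N(1)] E.vector_space_axioms obtain g where
    g: "isomorphism_between sF L sE N g" "homeomorphism N L f g" by blast
  note h = homeomorphism_properties[OF g(2)]
  have L: "F.subspace L" using isomorphism_subspace[OF iso N(1) E.vector_space_axioms F.vector_space_axioms] .
  have "closure L \<subseteq> L"
  proof
    fix y assume "y \<in> closure L"
    then obtain s where s: "\<And>l::nat. s l \<in> L" "s \<longlonglongrightarrow> y" using F.closure_sequence by metis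
    have gs: "g (s l) \<in> N" for l using h(4) s(1) by blast
    have diff: "g (s m - s n) = g (s m) - g (s n)" for m n
    proof -
      have "s m = (s m - s n) + s n" by simp
      moreover have "g ((s m - s n) + s n) = g (s m - s n) + g (s n)"
        using g(1) F.subspace_diff[OF L] s(1) unfolding isomorphism_between_def by blast
      ultimately show ?thesis by simp
    qed
    have "\<exists>N. \<forall>m\<ge>N. \<forall>n\<ge>N. pE k (g (s m) - g (s n)) < e" if e: "e > 0" for k e
    proof -
      obtain j C where jC: "\<forall>x\<in>L. pE k (g x) \<le> C * pF j x"
        using isomorphism_estimate[OF g(1) L F.defining_seminorms_axioms E.seminorms E.continuous] by blast
      have "0 < e / (2 * (\<bar>C\<bar> + 1))" using e by simp
      moreover have "(\<lambda>l. pF j (s l - y)) \<longlonglongrightarrow> 0" using s(2) unfolding F.tendsto_iff by blast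
      ultimately have "\<forall>\<^sub>F l in sequentially. pF j (s l - y) < e / (2 * (\<bar>C\<bar> + 1))"
        by (intro order_tendstoD)
      then obtain M where M: "\<And>l. l \<ge> M \<Longrightarrow> pF j (s l - y) < e / (2 * (\<bar>C\<bar> + 1))"
        unfolding eventually_sequentially by blast
      have "pE k (g (s m) - g (s n)) < e" if "m \<ge> M" "n \<ge> M" for m n
      proof -
        have "pF j (s m - s n) < 2 * (e / (2 * (\<bar>C\<bar> + 1)))"
          using F.triangle_via[of j "s m" "s n" y] F.commute[of j "s n" y] M[OF that(1)] M[OF that(2)]
          by linarith
        then have less: "(\<bar>C\<bar> + 1) * pF j (s m - s n) < e" by (simp add: field_simps)
        have "pE k (g (s m) - g (s n)) \<le> C * pF j (s m - s n)"
          using jC F.subspace_diff[OF L s(1) s(1)] unfolding diff[symmetric] by blast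
        also have "\<dots> \<le> (\<bar>C\<bar> + 1) * pF j (s m - s n)" by (intro mult_right_mono) auto
        finally show ?thesis using less by linarith
      qed
      then show ?thesis by blast
    qed
    from E.complete[OF this] obtain u where u: "(\<lambda>l. g (s l)) \<longlonglongrightarrow> u" by blast
    have uN: "u \<in> N" using closed_sequentially[OF N(2) gs u] .
    have "(\<lambda>l. f (g (s l))) \<longlonglongrightarrow> f u"
      by (rule continuous_on_tendsto_compose[OF h(1) u uN]) (simp add: gs)
    then have "s \<longlonglongrightarrow> f u" using h(6)[OF s(1)] by simp
    from F.limit_unique[OF s(2) this] show "y \<in> L" using h(3) uN by blast
  qed
  then show ?thesis using closure_subset_eq by blast
qed

lemma copy_of_subspace:
  assumes E: "frechet_space sE" and F: "frechet_space sF"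
    and N: "inf_closed_subspace sE N" and iso: "isomorphism_between sE N sF L f"
  shows "inf_closed_subspace sF L"
proof -
  interpret E: frechet_space sE by fact
  interpret F: frechet_space sF by fact
  show ?thesis
    using N isomorphic_image_closed[OF E F _ _ iso] isomorphism_subspace[OF iso _ E.vector_space_axioms F.vector_space_axioms]
      isomorphism_infinite_dimensional[OF iso _ E.vector_space_axioms F.vector_space_axioms]
    unfolding inf_closed_subspace_def by blast
qed

lemma bounded_strictly_singular:
  assumes E: "frechet_space sE" and F: "frechet_space sF"
    and "every_subspace_contains_copy sE sG" "has_no_subspace_isomorphic_to sF sG"
  shows "LB sE sF \<subseteq> L_s sE sF"
proof
  interpret E: frechet_space sE by fact
  fix T assume "T \<in> LB sE sF"
  then have "T \<in> continuous_linear_operators sE sF" unfolding LB_def by blast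
  moreover have False if M: "inf_closed_subspace sE M" and T: "isomorphism_between sE M sF (T ` M) T" for M
  proof -
    obtain N h where N: "inf_closed_subspace sE N" "N \<subseteq> M" and h: "isomorphism_between sE N sG UNIV h"
      using assms(3) M unfolding every_subspace_contains_copy_def isomorphic_subspaces_def by blast
    have TN: "isomorphism_between sE N sF (T ` N) T" using isomorphism_restrict[OF T N(2)] .
    from isomorphism_sym[OF TN _ E.vector_space_axioms] N(1) obtain g where
      "isomorphism_between sF (T ` N) sE N g" unfolding inf_closed_subspace_def by blast
    from isomorphism_trans[OF this h] copy_of_subspace[OF E F N(1) TN] show False
      using assms(4) unfolding has_no_subspace_isomorphic_to_def isomorphic_subspaces_def by blast
  qed
  ultimately show "T \<in> L_s sE sF" unfolding L_s_def by blast
qed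

section \<open>Non-normable copies and the necessity part\<close>

text \<open>The index \<open>q k\<close> at which largeness occurs may lie far beyond
  \<open>k\<close>; the subsequence jumps past it, so that consecutive norms are spread.\<close>

lemma (in graded_norms) exists_spread_subsequence:
  assumes "\<And>k. \<exists>q. \<forall>C. \<exists>x. C * p k x < p q x"
  shows "\<exists>s. strict_mono s \<and> spread_norms sc (\<lambda>i. p (s i))"
proof -
  from exists_spread[OF assms] have "\<forall>k. \<exists>q. \<forall>d>0. \<forall>H. \<exists>y. p k y < d \<and> (\<exists>e>0. \<forall>w. p k (w - y) < e \<longrightarrow> H < p q w)"
    by blast
  from choice[OF this] obtain q where
    q: "\<And>k d H. d > 0 \<Longrightarrow> \<exists>y. p k y < d \<and> (\<exists>e>0. \<forall>w. p k (w - y) < e \<longrightarrow> H < p (q k) w)"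
    by blast
  define s where "s = rec_nat 0 (\<lambda>_ k. max (Suc k) (q k))"
  have s_Suc: "s (Suc i) = max (Suc (s i)) (q (s i))" for i by (simp add: s_def)
  have s: "strict_mono s" by (simp add: strict_mono_Suc_iff s_Suc less_max_iff_disj)
  have "spread_norms sc (\<lambda>i. p (s i))"
  proof (intro spread_norms.intro graded_norms.intro graded_norms_axioms.intro spread_norms_axioms.intro)
    show "vector_space sc" by (rule vector_space_axioms)
  next
    fix k
    show "vector_norm sc (p (s k))" by (rule norms)
    show "p (s k) x \<le> p (s (Suc k)) x" for x by (intro mono) (simp add: s_Suc)
    show "\<exists>y. p (s k) y < d \<and> (\<exists>e>0. \<forall>w. p (s k) (w - y) < e \<longrightarrow> H < p (s (Suc k)) w)" if "d > 0" for d H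
    proof -
      from q[OF that] obtain y e where y: "p (s k) y < d" "e > 0"
        "\<And>w. p (s k) (w - y) < e \<Longrightarrow> H < p (q (s k)) w" by blast
      have "H < p (s (Suc k)) w" if "p (s k) (w - y) < e" for w
        using y(3)[OF that] mono[of "q (s k)" "s (Suc k)" w] by (simp add: s_Suc)
      with y show ?thesis by blast
    qed
  next
    fix x :: "nat \<Rightarrow> 'e"
    assume cauchy: "\<And>k e. e > 0 \<Longrightarrow> \<exists>N. \<forall>m\<ge>N. \<forall>n\<ge>N. p (s k) (x m - x n) < e"
    have "\<exists>N. \<forall>m\<ge>N. \<forall>n\<ge>N. p k (x m - x n) < e" if "e > 0" for k e
      \<comment> \<open>Since \<open>s k \<ge> k\<close>, being Cauchy for the subsequence implies
        it for all the norms.\<close>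
      using cauchy[OF that, of k] mono[OF seq_suble[OF s, of k]] by (meson le_less_trans)
    from complete[OF this] show "\<exists>u. \<forall>k. (\<lambda>n. p (s k) (x n - u)) \<longlonglongrightarrow> 0" by blast
  qed
  with s show ?thesis by blast
qed

lemma (in frechet_seminorms) graded_normsI:
  assumes "\<And>k x. p k x = 0 \<Longrightarrow> x = 0"
  shows "graded_norms sc p"
proof (intro graded_norms.intro graded_norms_axioms.intro)
  show "vector_space sc" by (rule vector_space_axioms)
  show "vector_norm sc (p k)" for k
    by unfold_locales (rule assms)
  show "p k x \<le> p (Suc k) x" for k x by (rule increasing)
  show "\<exists>u. \<forall>k. (\<lambda>n. p k (s n - u)) \<longlonglongrightarrow> 0"
    if "\<And>k e. e > 0 \<Longrightarrow> \<exists>N. \<forall>m\<ge>N. \<forall>n\<ge>N. p k (s m - s n) < e" for s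
    using complete[of s, OF that] unfolding tendsto_iff .
qed

text \<open>Riesz's argument: the unit ball of a normable space embedded in a Montel space as a closed
  subspace is contained in a compact set.\<close>

lemma normable_in_montel_finite_dimensional:
  fixes sF :: "'k::real_or_complex \<Rightarrow> 'f::topological_ab_group_add \<Rightarrow> 'f"
    and sG :: "'k \<Rightarrow> 'g::topological_ab_group_add \<Rightarrow> 'g"
  assumes F: "frechet_montel_space sF" and p: "defining_seminorms sG p" "vector_norm sG (p k)"
    and dom: "\<And>q. \<exists>C. \<forall>x. p q x \<le> C * p k x"
    and N: "closed N" and iso: "isomorphism_between sG UNIV sF N g"
  shows "\<not> infinite_dimensional sG UNIV"
proof -
  interpret F: frechet_montel_space sF by fact
  interpret p: defining_seminorms sG p by fact
  interpret n: vector_norm sG "p k" by fact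
  from isomorphism_sym[OF iso p.subspace_UNIV p.vector_space_axioms] obtain f where
    f: "isomorphism_between sF N sG UNIV f" "homeomorphism UNIV N g f" .
  note h = homeomorphism_properties[OF f(2)]
  have scale: "g (sG c x) = sF c (g x)" for c x using iso unfolding isomorphism_between_def by blast
  have g0: "g 0 = 0" using scale[of 0 0] by simp
  define B where "B = {x. p k x \<le> 1}"
  \<comment> \<open>Normability enters here: the unit ball of \<open>p k\<close> is bounded for
    every \<open>p q\<close>, hence its image is absorbed by every neighbourhood of 0 in
    \<open>F\<close>.\<close>
  have "tvs_bounded sF (g ` B)"
    unfolding tvs_bounded_def
  proof (intro allI impI)
    fix U :: "'f set" assume U: "open U" "0 \<in> U"
    have "open (g -` U)" by (intro open_vimage U h)
    moreover have "0 \<in> g -` U" using U(2) g0 by simp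
    ultimately obtain q e where qe: "e > 0" "{x. p q x < e} \<subseteq> g -` U" using p.neighbourhood by blast
    obtain C where C: "\<And>x. p q x \<le> C * p k x" using dom by blast
    let ?r = "(\<bar>C\<bar> + 1) / e"
    have r: "0 < ?r" using qe(1) by simp
    have "g ` B \<subseteq> sF c ` U" if c: "?r \<le> norm c" for c
    proof
      fix y assume "y \<in> g ` B"
      then obtain x where x: "y = g x" "p k x \<le> 1" unfolding B_def by blast
      have nc: "0 < norm c" using r c by linarith
      have "p q x \<le> \<bar>C\<bar> * p k x" using C[of x] mult_right_mono[OF abs_ge_self[of C] p.nonneg[of k x]] by linarith
      also have "\<dots> \<le> \<bar>C\<bar>" using x(2) by (simp add: mult_left_le)
      also have "\<dots> < e * ?r" using qe(1) by simp
      also have "\<dots> \<le> e * norm c" using c qe(1) by (intro mult_left_mono) auto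
      finally have "p q (sG (inverse c) x) < e"
        unfolding p.homogeneous norm_inverse using nc
        by (simp add: inverse_eq_divide divide_less_eq mult.commute)
      then have "g (sG (inverse c) x) \<in> U" using qe(2) by blast
      moreover have "y = sF c (g (sG (inverse c) x))" using nc by (simp add: scale x(1))
      ultimately show "y \<in> sF c ` U" by blast
    qed
    with r show "\<exists>r>0. \<forall>c. r \<le> norm c \<longrightarrow> g ` B \<subseteq> sF c ` U" by blast
  qed
  then have comp: "compact (closure (g ` B))" by (rule F.montel)
  have cN: "closure (g ` B) \<subseteq> N" using h(3) by (intro closure_minimal N) blast
  define K where "K = f ` closure (g ` B)"
  have "compact K" unfolding K_def
    by (rule compact_continuous_image[OF continuous_on_subset[OF h(2) cN] comp])
  have BK: "B \<subseteq> K"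
  proof
    fix x assume "x \<in> B"
    from subsetD[OF closure_subset imageI[OF this]] have "f (g x) \<in> K"
      unfolding K_def by (rule imageI)
    then show "x \<in> K" using h(5) by simp
  qed
  have "K \<subseteq> (\<Union>x\<in>K. {y. p k (y - x) < 1 / 2})" by force
  with \<open>compact K\<close> obtain D where D: "finite D" "K \<subseteq> (\<Union>x\<in>D. {y. p k (y - x) < 1 / 2})"
    by (rule compactE_image[OF _ p.open_ball])
  \<comment> \<open>The finite net \<open>D\<close> of mesh 1/2 is applied to the rescaled error,
    which halves at each pass. So \<open>p.span D\<close> is dense for \<open>p k\<close>; being
    finite-dimensional it is also closed, hence everything.\<close>
  have approx: "\<exists>y\<in>p.span D. p k (x - y) \<le> p k x * (1 / 2) ^ m" for x m
  proof (induction m)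
    case 0
    show ?case using p.span_zero by (intro bexI[of _ 0]) auto
  next
    case (Suc m)
    then obtain y where y: "y \<in> p.span D" "p k (x - y) \<le> p k x * (1 / 2) ^ m" by blast
    show ?case
    proof (cases "x = y")
      case True
      then show ?thesis using y(1) by (intro bexI[of _ y]) auto
    next
      case False
      define t where "t = p k (x - y)"
      have t: "0 < t" using False by (simp add: t_def)
      define c :: 'k where "c = of_real t"
      have c: "norm c = t" "c \<noteq> 0" using t unfolding c_def norm_of_real by simp_all
      have "sG (inverse c) (x - y) \<in> B" using t by (simp add: B_def p.homogeneous norm_inverse c flip: t_def)
      then obtain z where z: "z \<in> D" "p k (sG (inverse c) (x - y) - z) < 1 / 2" using BK D(2) by blast
      have "x - (y + sG c z) = sG c (sG (inverse c) (x - y) - z)"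
        unfolding p.scale_right_diff_distrib[of c _ z] p.scale_scale using c(2) by (simp add: diff_diff_eq)
      then have "p k (x - (y + sG c z)) \<le> t * (1 / 2)"
        using z(2) t by (simp add: p.homogeneous c)
      also have "\<dots> \<le> p k x * (1 / 2) ^ Suc m" using y(2) by (simp add: t_def)
      finally show ?thesis
        by (intro bexI[of _ "y + sG c z"] p.span_add p.span_scale p.span_base y z)
    qed
  qed
  have "x \<in> p.span D" for x
  proof (rule n.finite_span_closed[OF D(1)])
    fix e :: real assume e: "e > 0"
    have "(\<lambda>m. p k x * (1 / 2) ^ m) \<longlonglongrightarrow> 0"
      by (intro tendsto_mult_right_zero LIMSEQ_power_zero) simp
    from order_tendstoD(2)[OF this e] obtain m where "p k x * (1 / 2) ^ m < e"
      unfolding eventually_sequentially by blast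
    then show "\<exists>y\<in>p.span D. p k (x - y) < e" using approx[of x m] by (meson le_less_trans)
  qed
  then have "p.span D = UNIV" by blast
  then show ?thesis using D(1) unfolding infinite_dimensional_def by blast
qed

text \<open>Adding the continuous norm of \<open>F\<close>, pulled back along the embedding, makes
  each seminorm definite. Continuity is kept, and as the seminorms only grow they still define the
  topology.\<close>

lemma embedding_gives_norms:
  fixes sF :: "'k::real_or_complex \<Rightarrow> 'f::topological_ab_group_add \<Rightarrow> 'f"
    and sG :: "'k \<Rightarrow> 'g::topological_ab_group_add \<Rightarrow> 'g"
  assumes G: "frechet_space sG" and "admits_continuous_norm sF" and iso: "isomorphism_between sG UNIV sF N g"
  shows "\<exists>p. frechet_seminorms sG p \<and> graded_norms sG p"
proof -
  interpret G: frechet_space sG by fact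
  obtain q where "defining_seminorms sG q" using G.exists_defining_seminorms by blast
  then interpret q: defining_seminorms sG q .
  obtain n :: "'f \<Rightarrow> real" where n: "continuous_on UNIV n" "\<And>x. 0 \<le> n x" "\<And>x. n x = 0 \<longleftrightarrow> x = 0"
    "\<And>x y. n (x + y) \<le> n x + n y" "\<And>c x. n (sF c x) = norm c * n x"
    using assms(2) unfolding admits_continuous_norm_def by blast
  obtain f where f: "homeomorphism UNIV N g f" using iso unfolding isomorphism_between_def by blast
  note h = homeomorphism_properties[OF f]
  have add: "g (x + y) = g x + g y" and scale: "g (sG c x) = sF c (g x)" for c x y
    using iso unfolding isomorphism_between_def by blast+
  have g0: "x = 0" if "g x = 0" for x
    using h(5)[of x] h(5)[of 0] that add[of 0 0] by simp
  define p where "p k x = q k x + n (g x)" for k x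
  have "defining_seminorms sG p"
  proof (intro defining_seminorms.intro defining_seminorms_axioms.intro)
    show "topological_vector_space sG" by (rule G.topological_vector_space_axioms)
    show "seminorm sG (p k)" for k
    proof (intro seminorm.intro seminorm_axioms.intro)
      show "vector_space sG" by (rule G.vector_space_axioms)
      show "p k (x + y) \<le> p k x + p k y" for x y
        using q.triangle[of k x y] n(4)[of "g x" "g y"] by (simp add: p_def add)
      show "p k (sG c x) = norm c * p k x" for c x
        by (simp add: p_def scale n(5) q.homogeneous distrib_left)
    qed
    show "continuous_on UNIV (p k)" for k
      unfolding p_def[abs_def]
      by (intro continuous_on_add q.continuous continuous_on_compose2[OF n(1) h(1)] subset_UNIV)
    show "p k x \<le> p (Suc k) x" for k x using q.increasing by (simp add: p_def)
    show "\<exists>k. \<exists>e>0. {x. p k x < e} \<subseteq> U" if "open U" "0 \<in> U" for U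
    proof -
      from q.neighbourhood[OF that] obtain k e where ke: "e > 0" "{x. q k x < e} \<subseteq> U" by blast
      have "q k x \<le> p k x" for x using n(2) by (simp add: p_def)
      then have "{x. p k x < e} \<subseteq> {x. q k x < e}" using le_less_trans by blast
      with ke show ?thesis by (meson order_trans)
    qed
  qed
  then have p: "frechet_seminorms sG p" by (rule frechet_seminorms.intro[OF G])
  moreover have "graded_norms sG p"
  proof (rule frechet_seminorms.graded_normsI[OF p])
    fix k x assume "p k x = 0"
    then have "n (g x) = 0" using n(2)[of "g x"] q.nonneg[of k x] unfolding p_def by linarith
    then show "x = 0" using n(3) g0 by blast
  qed
  ultimately show ?thesis by blast
qed

text \<open>Translation from norms to topology: \<open>isomorphism_estimate\<close> supplies the
  constants, for \<open>\<phi>\<close> in every norm and for its inverse in the lowest one.\<close>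

lemma exists_closed_unembeddable_subspace:
  fixes sG :: "'k::real_or_complex \<Rightarrow> 'g::topological_ab_group_add \<Rightarrow> 'g"
  assumes "frechet_seminorms sG p" "graded_norms sG p" "infinite_dimensional sG UNIV"
    and "\<And>k. \<exists>q. \<forall>C. \<exists>x. C * p k x < p q x"
  shows "\<exists>M. inf_closed_subspace sG M \<and>
    \<not> (\<exists>\<phi> L. L \<subseteq> M \<and> isomorphism_between sG UNIV sG L \<phi>)"
proof -
  interpret p: frechet_seminorms sG p by fact
  interpret g: graded_norms sG p by fact
  obtain s where s: "strict_mono s" "spread_norms sG (\<lambda>i. p (s i))"
    using g.exists_spread_subsequence[OF assms(4)] by blast
  interpret s: spread_norms sG "\<lambda>i. p (s i)" by (rule s(2))
  have ds: "defining_seminorms sG (\<lambda>i. p (s i))"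
  proof (intro defining_seminorms.intro defining_seminorms_axioms.intro)
    show "topological_vector_space sG" by (rule p.topological_vector_space_axioms)
    show "seminorm sG (p (s k))" "continuous_on UNIV (p (s k))" for k
      by (rule p.seminorms p.continuous)+
    show "p (s k) x \<le> p (s (Suc k)) x" for k x by (rule s.increasing)
    show "\<exists>k. \<exists>e>0. {x. p (s k) x < e} \<subseteq> U" if "open U" "0 \<in> U" for U
    proof -
      from p.neighbourhood[OF that] obtain k e where ke: "e > 0" "{x. p k x < e} \<subseteq> U" by blast
      have "{x. p (s k) x < e} \<subseteq> {x. p k x < e}"
        using p.mono[OF seq_suble[OF s(1), of k]] le_less_trans by blast
      with ke show ?thesis by (meson order_trans)
    qed
  qed
  from s.exists_unembeddable_subspace[OF assms(3)] obtain M where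
    M: "p.subspace M" "s.cl M = M" "infinite_dimensional sG M"
    and no: "\<And>\<phi> k C. Vector_Spaces.linear sG sG \<phi> \<Longrightarrow> range \<phi> \<subseteq> M \<Longrightarrow>
      (\<forall>x. p (s 0) x \<le> C * p (s k) (\<phi> x)) \<Longrightarrow>
      (\<forall>q. \<exists>r D. \<forall>x. p (s q) (\<phi> x) \<le> D * p (s r) x) \<Longrightarrow> False"
    by metis
  have "open (- M)"
  proof (subst open_subopen, intro ballI)
    fix x assume "x \<in> - M"
    then have "x \<notin> s.cl M" using M(2) by simp
    then obtain k e where ke: "e > 0" "\<And>y. y \<in> M \<Longrightarrow> e \<le> p (s k) (x - y)"
      unfolding s.cl_def by (auto simp: not_less)
    have "{y. p (s k) (y - x) < e} \<subseteq> - M"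
      using ke(2) p.commute[of "s k" x] by (auto simp: not_less[symmetric])
    moreover have "x \<in> {y. p (s k) (y - x) < e}" using ke(1) by simp
    ultimately show "\<exists>T. open T \<and> x \<in> T \<and> T \<subseteq> - M" using p.open_ball by blast
  qed
  then have "inf_closed_subspace sG M" using M unfolding inf_closed_subspace_def by (simp add: closed_def)
  moreover have False if L: "L \<subseteq> M" and \<phi>: "isomorphism_between sG UNIV sG L \<phi>" for L \<phi>
  proof -
    from isomorphism_sym[OF \<phi> p.subspace_UNIV p.vector_space_axioms] obtain \<psi> where
      \<psi>: "isomorphism_between sG L sG UNIV \<psi>" "homeomorphism UNIV L \<phi> \<psi>" .
    note h = homeomorphism_properties[OF \<psi>(2)]
    have sub: "p.subspace L"
      using isomorphism_subspace[OF \<phi> p.subspace_UNIV p.vector_space_axioms p.vector_space_axioms] .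
    obtain k C where kC: "\<forall>x\<in>L. p (s 0) (\<psi> x) \<le> C * p (s k) x"
      using isomorphism_estimate[OF \<psi>(1) sub ds p.seminorms p.continuous] by blast
    show False
    proof (rule no)
      show "Vector_Spaces.linear sG sG \<phi>"
        using \<phi> p.vector_space_axioms unfolding Vector_Spaces.linear_iff isomorphism_between_def by blast
      show "range \<phi> \<subseteq> M" using h(3) L by simp
      show "\<forall>x. p (s 0) x \<le> C * p (s k) (\<phi> x)" using kC h(3,5) by auto
      show "\<forall>q. \<exists>r D. \<forall>x. p (s q) (\<phi> x) \<le> D * p (s r) x"
        using isomorphism_estimate[OF \<phi> p.subspace_UNIV ds p.seminorms p.continuous] by simp
    qed
  qed
  ultimately have "inf_closed_subspace sG M \<and>
      \<not> (\<exists>\<phi> L. L \<subseteq> M \<and> isomorphism_between sG UNIV sG L \<phi>)" by auto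
  then show ?thesis by (rule exI)
qed

text \<open>As \<open>E\<close> is infinite-dimensional, condition (1) applied to \<open>E\<close>
  itself gives a copy of \<open>G\<close> in \<open>E\<close>. A subspace of \<open>G\<close> is
  moved into this copy, is found there to contain a copy of \<open>G\<close>, and that copy is moved
  back.\<close>

lemma every_subspace_contains_copy_transfer:
  assumes E: "frechet_space sE" and G: "frechet_space sG"
    and inf: "infinite_dimensional sE UNIV" and copy: "every_subspace_contains_copy sE sG"
    and M: "inf_closed_subspace sG M"
  shows "\<exists>\<phi> L. L \<subseteq> M \<and> isomorphism_between sG UNIV sG L \<phi>"
proof -
  interpret E: frechet_space sE by fact
  interpret G: frechet_space sG by fact
  have "inf_closed_subspace sE UNIV" using inf E.subspace_UNIV unfolding inf_closed_subspace_def by simp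
  then obtain N f where N: "inf_closed_subspace sE N" and f: "isomorphism_between sE N sG UNIV f"
    using copy unfolding every_subspace_contains_copy_def isomorphic_subspaces_def by blast
  have Nsub: "E.subspace N" using N unfolding inf_closed_subspace_def by blast
  from isomorphism_sym[OF f Nsub E.vector_space_axioms] obtain g where
    g: "isomorphism_between sG UNIV sE N g" "homeomorphism N UNIV f g" .
  have gM: "isomorphism_between sG M sE (g ` M) g" by (rule isomorphism_restrict[OF g(1) subset_UNIV])
  from copy_of_subspace[OF G E M gM] copy obtain N' h where
    N': "inf_closed_subspace sE N'" "N' \<subseteq> g ` M" and h: "isomorphism_between sE N' sG UNIV h"
    unfolding every_subspace_contains_copy_def isomorphic_subspaces_def by blast
  have "E.subspace N'" using N'(1) unfolding inf_closed_subspace_def by blast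
  from isomorphism_sym[OF h this E.vector_space_axioms] obtain k where
    k: "isomorphism_between sG UNIV sE N' k" by blast
  note hom = homeomorphism_properties[OF g(2)]
  have "N' \<subseteq> N" using N'(2) hom(4) by blast
  from isomorphism_trans[OF k isomorphism_restrict[OF f this]]
  have "isomorphism_between sG UNIV sG (f ` N') (f \<circ> k)" .
  moreover have "f ` N' \<subseteq> M" using N'(2) hom(6) by fastforce
  ultimately show ?thesis by blast
qed

theorem theorem3:
  fixes sE :: "'k::real_or_complex \<Rightarrow> 'e::topological_ab_group_add \<Rightarrow> 'e"
    and sF :: "'k \<Rightarrow> 'f::topological_ab_group_add \<Rightarrow> 'f"
    and sG :: "'k \<Rightarrow> 'g::topological_ab_group_add \<Rightarrow> 'g"
  assumes "frechet_space sE" and "frechet_space sF" and "frechet_space sG"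
  shows "(every_subspace_contains_copy sE sG \<and> has_no_subspace_isomorphic_to sF sG
            \<longrightarrow> LB sE sF \<subseteq> L_s sE sF) \<and>
         (infinite_dimensional sE UNIV \<and> frechet_montel_space sF \<and> admits_continuous_norm sF \<and>
          every_subspace_contains_copy sE sG \<and> LB sE sF \<subseteq> L_s sE sF
            \<longrightarrow> has_no_subspace_isomorphic_to sF sG)"
proof (intro conjI impI)
  assume "every_subspace_contains_copy sE sG \<and> has_no_subspace_isomorphic_to sF sG"
  then show "LB sE sF \<subseteq> L_s sE sF" using bounded_strictly_singular[OF assms(1,2)] by blast
next
  interpret F: frechet_space sF by (rule assms(2))
  interpret G: frechet_space sG by (rule assms(3))
  assume *: "infinite_dimensional sE UNIV \<and> frechet_montel_space sF \<and> admits_continuous_norm sF \<and>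
          every_subspace_contains_copy sE sG \<and> LB sE sF \<subseteq> L_s sE sF"
  show "has_no_subspace_isomorphic_to sF sG"
    unfolding has_no_subspace_isomorphic_to_def isomorphic_subspaces_def
  proof
    assume "\<exists>N. inf_closed_subspace sF N \<and> (\<exists>f. isomorphism_between sF N sG UNIV f)"
    then obtain N f where N: "inf_closed_subspace sF N" and f: "isomorphism_between sF N sG UNIV f"
      by blast
    have N': "F.subspace N" "closed N" "infinite_dimensional sF N"
      using N unfolding inf_closed_subspace_def by blast+
    have inf: "infinite_dimensional sG UNIV"
      by (rule isomorphism_infinite_dimensional[OF f N'(1) F.vector_space_axioms G.vector_space_axioms N'(3)])
    from isomorphism_sym[OF f N'(1) F.vector_space_axioms] obtain g where
      g: "isomorphism_between sG UNIV sF N g" by blast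
    obtain p where p: "frechet_seminorms sG p" "graded_norms sG p"
      using embedding_gives_norms[OF assms(3) _ g] * by blast
    have "\<exists>q. \<forall>C. \<exists>x. C * p k x < p q x" for k
    proof (rule ccontr)
      assume "\<not> ?thesis"
      \<comment> \<open>Failure at one \<open>k\<close> means that \<open>p k\<close> dominates all
        the norms, that is, \<open>G\<close> is normable.\<close>
      then have "\<exists>C. \<forall>x. p q x \<le> C * p k x" for q by (meson not_le)
      from normable_in_montel_finite_dimensional[OF _ frechet_seminorms.axioms(2)[OF p(1)]
          graded_norms.norms[OF p(2)] this N'(2) g]
      show False using * inf by blast
    qed
    from exists_closed_unembeddable_subspace[OF p inf this] show False
      using every_subspace_contains_copy_transfer[OF assms(1,3)] * by blast
  qed
qed

end
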